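(* The holomorphic solution $\widetilde{w}_3$ at the origin of the differential equation \begin{equation*} \Big(z(1-z)^2\partial_z^2+(1-3z)(1-z)\partial_z+z-\tfrac34\Big) w(z)=\frac12\, {}_2F_1\!\left(1,1;\frac32;z\right) \end{equation*} with the initial condition $\widetilde{w}_3(0)=0$ is given by \begin{equation*} \widetilde{w}_3(z) =-2\sum_{n=0}^\infty \left( \sum_{k=0}^n(-1)^k\binom{-\frac12}{k}^{\!\!2}\binom{n}{k} \sum_{j=0}^{k-1} \frac{1}{(2j+1)^3}\binom{-\frac12}{j}^{\!\!\!-2} \right)z^n. \end{equation*} In particular, \begin{equation*} \widetilde{J}_3(n)=-2\sum_{k=0}^n(-1)^k\binom{-\frac12}{k}^{\!\!2}\binom{n}{k} \sum_{j=0}^{k-1} \frac{1}{(2j+1)^3}\binom{-\frac12}{j}^{\!\!\!-2}. \end{equation*}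
   Context: Here ${}_2F_1$ is the Gauss hypergeometric function and $\partial_z=d/dz$. For $n\ge0$ let \begin{equation*} J_2(n) := \int_0^\infty\!\!\int_0^\infty \frac{e^{-(t+s)/2}}{1-e^{-(t+s)}}\left(\frac{(1-e^{-2t})(1-e^{-2s})}{(1-e^{-(t+s)})^2}\right)^{\!n}dt\,ds, \end{equation*} \begin{equation*} J_3(n) := \int_0^\infty\!\!\int_0^\infty\!\!\int_0^\infty \frac{e^{-(t+s+u)/2}}{1-e^{-(t+s+u)}}\left(\frac{(1-e^{-2t})(1-e^{-2(s+u)})}{(1-e^{-(t+s+u)})^2}\right)^{\!n}dt\,ds\,du, \end{equation*} and set $\widetilde{J}_2(n):=J_2(n)/J_2(0)$, $\widetilde{J}_3(n):=J_3(n)-J_3(0)\widetilde{J}_2(n)$. Equivalently, $\widetilde{J}_3(n)$ is determined by $\widetilde{J}_3(0)=0$, $\widetilde{J}_3(1)=\frac12$ and the recurrence $4n^2 \widetilde{J}_3(n)-(8n^2-8n+3)\widetilde{J}_3(n-1)+4(n-1)^2\widetilde{J}_3(n-2)=\frac{2^n(n-1)!}{(2n-1)!!}$ for $n\ge2$. Let $\widetilde{w}_3(z):=\sum_{n\ge0}\widetilde{J}_3(n)z^n$; it satisfies the inhomogeneous singly confluent Heun equation in the claim. (Any holomorphic solution at $0$ of that equation is $c\,\widetilde{w}_2+\widetilde{w}_3$ with $\widetilde{w}_2(z)=\sum_{n\ge0}\widetilde{J}_2(n)z^n$, which solves the corresponding homogeneous equation.) *)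

theory Defs
  imports "HOL-Complex_Analysis.Complex_Analysis"
begin

text \<open>
  The integrands are nonnegative, so each iterated integral is a single Lebesgue integral
  over the product, and the order of integration is irrelevant.
\<close>

definition J2 :: "nat \<Rightarrow> real" where
  "J2 n = (LINT p : {0<..} \<times> {0<..} | (lborel :: (real \<times> real) measure).
     (case p of (t, s) \<Rightarrow>
        exp (- (t + s) / 2) / (1 - exp (- (t + s))) *
        ((1 - exp (- 2 * t)) * (1 - exp (- 2 * s)) / (1 - exp (- (t + s)))\<^sup>2) ^ n))"

definition J3 :: "nat \<Rightarrow> real" where
  "J3 n = (LINT p : {0<..} \<times> {0<..} \<times> {0<..} | (lborel :: (real \<times> real \<times> real) measure).
     (case p of (t, s, u) \<Rightarrow>
        exp (- (t + s + u) / 2) / (1 - exp (- (t + s + u))) *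
        ((1 - exp (- 2 * t)) * (1 - exp (- 2 * (s + u))) / (1 - exp (- (t + s + u)))\<^sup>2) ^ n))"

definition J2_tilde :: "nat \<Rightarrow> real" where
  "J2_tilde n = J2 n / J2 0"

definition J3_tilde :: "nat \<Rightarrow> real" where
  "J3_tilde n = J3 n - J3 0 * J2_tilde n"

definition w3_tilde :: "complex \<Rightarrow> complex" where
  "w3_tilde z = (\<Sum>n. complex_of_real (J3_tilde n) * z ^ n)"

text \<open>The Gauss hypergeometric function, as the sum of its power series (so for \<open>norm z < 1\<close> only).\<close>

definition hyp2F1 :: "complex \<Rightarrow> complex \<Rightarrow> complex \<Rightarrow> complex \<Rightarrow> complex" where
  "hyp2F1 a b c z = eval_fps (fps_hypergeo [a, b] [c] 1) z"

definition heun_op :: "(complex \<Rightarrow> complex) \<Rightarrow> complex \<Rightarrow> complex" where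
  "heun_op w z = z * (1 - z)\<^sup>2 * deriv (deriv w) z
     + (1 - 3 * z) * (1 - z) * deriv w z + (z - 3 / 4) * w z"

text \<open>
  The radius is at most 1 because the right-hand side is given by its power series at 0,
  whose radius of convergence is 1.
\<close>

definition heun_solution_on_disc :: "real \<Rightarrow> (complex \<Rightarrow> complex) \<Rightarrow> bool" where
  "heun_solution_on_disc r w \<longleftrightarrow> 0 < r \<and> r \<le> 1 \<and> w holomorphic_on ball 0 r \<and>
     (\<forall>z\<in>ball 0 r. heun_op w z = 1 / 2 * hyp2F1 1 1 (3 / 2) z)"

text \<open>The coefficient sum without the overall factor \<open>-2\<close>.\<close>

definition w3_bracket :: "nat \<Rightarrow> real" where
  "w3_bracket n = (\<Sum>k=0..n. (- 1) ^ k * ((- 1 / 2) gchoose k)\<^sup>2 * real (n choose k) *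
     (\<Sum>j<k. 1 / (2 * real j + 1) ^ 3 * ((- 1 / 2) gchoose j) powi (- 2)))"

end

theory Submission
  imports Defs "HOL-Real_Asymp.Real_Asymp"
begin

text \<open>
  With \<open>t = y + x\<close> and \<open>v = y - x\<close> (where \<open>v = s + u\<close> in \<open>J3\<close>), the ratio in the integrands becomes
  \<open>1 - (sinh x / sinh y)\<^sup>2\<close>. Expanding its \<open>n\<close>-th power binomially, \<open>J2 n\<close> and \<open>J3 n\<close> are the binomial
  transforms of \<open>2 B k\<close> and \<open>2 A k\<close>, where \<open>B k\<close> and \<open>A k\<close> are the integrals over \<open>y > 0\<close> of
  \<open>g k y\<close> and \<open>y * g k y\<close>, and \<open>g k y\<close> is the integral of \<open>sinh ^ (2 * k)\<close> from \<open>0\<close> to \<open>y\<close>, divided by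
  \<open>sinh y ^ (2 * k + 1)\<close>. The differential-difference equation
  \<open>g k'' = (2 * k + 1)\<^sup>2 * g k - (2 * k + 2)\<^sup>2 * g (k + 1)\<close>
  integrates to first-order recurrences in \<open>k\<close> for \<open>B\<close> and \<open>A\<close>, whose solutions give the closed form.
  The second-order operator in \<open>n\<close> that the Heun operator induces on coefficients maps the binomial
  transform of \<open>c\<close> to that of \<open>(2 * k + 1)\<^sup>2 * c k - 4 * (k + 1)\<^sup>2 * c (k + 1)\<close>; for \<open>J3_tilde\<close> this is
  \<open>2 / (2 * k + 1)\<close>, whose transform is the hypergeometric right-hand side.
\<close>

section \<open>Integrals of even powers of the hyperbolic sine\<close>

text \<open>The integral of \<open>sinh ^ (2 * k)\<close> from \<open>0\<close>, defined by the reduction formula that integration by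
  parts gives; so it is available, as an odd function, on the whole line.\<close>

primrec sinh_int :: "nat \<Rightarrow> real \<Rightarrow> real" where
  "sinh_int 0 y = y"
| "sinh_int (Suc k) y =
     (sinh y ^ (2 * k + 1) * cosh y - (2 * real k + 1) * sinh_int k y) / (2 * real k + 2)"

lemma cosh_sq: "cosh (y::real) * cosh y = 1 + sinh y * sinh y"
  using cosh_square_eq[of y] by (simp add: power2_eq_square)

text \<open>In the induction step \<open>cosh_sq\<close> collapses the derivative of the reduction
  formula to \<open>sinh y ^ (2 * k + 2)\<close>. With the value 0 at the origin this identifies
  \<open>sinh_int k\<close> as the intended integral.\<close>

lemma DERIV_sinh_int [derivative_intros]:
  "(sinh_int k has_real_derivative sinh y ^ (2 * k)) (at y)"
proof (induction k)
  case 0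
  then show ?case by (simp add: DERIV_ident)
next
  case (Suc k)
  have "((\<lambda>y. (sinh y ^ (2 * k + 1) * cosh y - (2 * real k + 1) * sinh_int k y) / (2 * real k + 2))
     has_real_derivative
      ((2 * real k + 1) * sinh y ^ (2 * k) * (cosh y * cosh y) + sinh y ^ (2 * k + 1) * sinh y
        - (2 * real k + 1) * sinh y ^ (2 * k)) / (2 * real k + 2)) (at y)"
    by (rule derivative_eq_intros Suc refl | simp)+
  moreover have "((2 * real k + 1) * sinh y ^ (2 * k) * (cosh y * cosh y) + sinh y ^ (2 * k + 1) * sinh y
        - (2 * real k + 1) * sinh y ^ (2 * k)) / (2 * real k + 2) = sinh y ^ (2 * Suc k)"
    unfolding cosh_sq by (simp add: field_simps)
  ultimately show ?case
    by simp
qed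

lemma sinh_int_at_0 [simp]: "sinh_int k 0 = 0"
  by (induction k) auto

lemma sinh_int_minus: "sinh_int k (- y) = - sinh_int k y"
  by (induction k) (simp_all add: field_simps)

lemma continuous_on_sinh_int: "continuous_on S (sinh_int k)"
  by (meson DERIV_continuous DERIV_sinh_int continuous_at_imp_continuous_on)

lemma sinh_le_mult_cosh:
  assumes "0 \<le> (y::real)"
  shows "sinh y \<le> y * cosh y"
proof -
  have "(\<lambda>y. y * cosh y - sinh y) 0 \<le> (\<lambda>y. y * cosh y - sinh y) y"
    by (rule DERIV_nonneg_imp_nondecreasing[OF assms])
       (rule exI, rule conjI, (rule derivative_eq_intros refl | simp)+)
  then show ?thesis by simp
qed

lemma sinh_int_nonneg: "0 \<le> y \<Longrightarrow> 0 \<le> sinh_int k y"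
proof -
  assume y: "0 \<le> y"
  have "sinh_int k 0 \<le> sinh_int k y"
    by (rule DERIV_nonneg_imp_nondecreasing[OF y])
       (use DERIV_sinh_int in \<open>auto intro!: exI\<close>)
  then show ?thesis by simp
qed

text \<open>The difference of the two sides vanishes at 0 and has derivative
  \<open>(2 * k + 1) * sinh y * sinh_int k y\<close>, which is nonnegative. With the upper bound
  that follows, this drives every limit at 0 and at infinity.\<close>

lemma sinh_int_lower:
  assumes "0 \<le> y"
  shows "sinh y ^ (2 * k + 1) \<le> (2 * real k + 1) * (cosh y * sinh_int k y)"
proof -
  let ?f = "\<lambda>y. (2 * real k + 1) * (cosh y * sinh_int k y) - sinh y ^ (2 * k + 1)"
  have "?f 0 \<le> ?f y"
  proof (rule DERIV_nonneg_imp_nondecreasing[OF assms])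
    fix x :: real assume x: "0 \<le> x"
    have "(?f has_real_derivative (2 * real k + 1) * (sinh x * sinh_int k x)) (at x)"
      by (rule derivative_eq_intros refl | simp add: algebra_simps)+
    moreover have "0 \<le> (2 * real k + 1) * (sinh x * sinh_int k x)"
      using x sinh_int_nonneg[OF x] by simp
    ultimately show "\<exists>y. (?f has_real_derivative y) (at x) \<and> 0 \<le> y" by blast
  qed
  then show ?thesis by simp
qed

lemma sinh_int_upper:
  assumes "0 \<le> y"
  shows "(2 * real k + 1) * sinh_int k y \<le> y * sinh y ^ (2 * k)"
proof (cases k)
  \<comment> \<open>The derivative of the difference is
    \<open>2 * k * sinh x ^ (2 * k - 1) * (x * cosh x - sinh x)\<close>; writing
    \<open>k = Suc m\<close> avoids the truncated exponent.\<close>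
  case (Suc m)
  let ?f = "\<lambda>y. y * sinh y ^ (2 * k) - (2 * real k + 1) * sinh_int k y"
  have "?f 0 \<le> ?f y"
  proof (rule DERIV_nonneg_imp_nondecreasing[OF assms])
    fix x :: real assume x: "0 \<le> x"
    have "((\<lambda>x. sinh x ^ (2 * k)) has_real_derivative
        2 * real k * (sinh x ^ (2 * m + 1) * cosh x)) (at x)"
      by (rule derivative_eq_intros refl | simp add: Suc algebra_simps)+
    then have "(?f has_real_derivative 2 * real k * sinh x ^ (2 * m + 1) * (x * cosh x - sinh x)) (at x)"
      by - (rule derivative_eq_intros refl | assumption | simp add: Suc algebra_simps)+
    moreover have "0 \<le> 2 * real k * sinh x ^ (2 * m + 1) * (x * cosh x - sinh x)"
      using x sinh_le_mult_cosh[OF x] by (intro mult_nonneg_nonneg) auto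
    ultimately show "\<exists>y. (?f has_real_derivative y) (at x) \<and> 0 \<le> y" by blast
  qed
  then show ?thesis by (simp add: Suc)
qed simp

section \<open>The normalised quotients and their differential-difference equation\<close>

text \<open>This is the function \<open>g k\<close> of the opening text.\<close>

definition sinh_quot :: "nat \<Rightarrow> real \<Rightarrow> real" where
  "sinh_quot k y = sinh_int k y / sinh y ^ (2 * k + 1)"

text \<open>The derivative of \<open>sinh_quot k\<close>, written through \<open>sinh_quot k\<close>
  itself so that bounds on the quotient carry over to the derivative.\<close>

definition sinh_quot' :: "nat \<Rightarrow> real \<Rightarrow> real" where
  "sinh_quot' k y = 1 / sinh y - (2 * real k + 1) * (cosh y / sinh y) * sinh_quot k y"

lemma sinh_quot_Suc:
  assumes "0 < y"
  shows "sinh_quot (Suc k) y =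
    (cosh y - (2 * real k + 1) * sinh_quot k y) / ((2 * real k + 2) * (sinh y)\<^sup>2)"
proof -
  have "sinh y > 0" using assms by simp
  then show ?thesis
    by (simp add: sinh_quot_def divide_simps) (simp add: algebra_simps power2_eq_square)
qed

lemma DERIV_sinh_quot:
  assumes "0 < y"
  shows "(sinh_quot k has_real_derivative sinh_quot' k y) (at y)"
proof -
  have s: "sinh y > 0" using assms by simp
  have "((\<lambda>y. sinh_int k y / sinh y ^ (2 * k + 1)) has_real_derivative
     (sinh y ^ (2 * k) * sinh y ^ (2 * k + 1)
       - sinh_int k y * ((2 * real k + 1) * sinh y ^ (2 * k) * cosh y))
     / (sinh y ^ (2 * k + 1) * sinh y ^ (2 * k + 1))) (at y)"
    using s by - (rule derivative_eq_intros refl | simp)+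
  moreover have "(sinh y ^ (2 * k) * sinh y ^ (2 * k + 1)
       - sinh_int k y * ((2 * real k + 1) * sinh y ^ (2 * k) * cosh y))
     / (sinh y ^ (2 * k + 1) * sinh y ^ (2 * k + 1)) = sinh_quot' k y"
    using s by (simp add: sinh_quot'_def sinh_quot_def divide_simps) (simp add: algebra_simps)
  ultimately show ?thesis
    by (simp add: sinh_quot_def[abs_def])
qed

text \<open>Differentiation leaves terms over \<open>(sinh y)\<^sup>2\<close>; the reduction formula
  \<open>sinh_quot_Suc\<close> absorbs them into \<open>sinh_quot (Suc k)\<close>. Integrating this
  identity yields the recurrences for the moments.\<close>

lemma DERIV_sinh_quot':
  assumes "0 < y"
  shows "(sinh_quot' k has_real_derivative
    (2 * real k + 1)\<^sup>2 * sinh_quot k y - (2 * real k + 2)\<^sup>2 * sinh_quot (Suc k) y) (at y)"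
proof -
  have s: "sinh y > 0" using assms by simp
  define m where "m = 2 * real k + 1"
  define q where "q = sinh_quot k y"
  have "((\<lambda>y. 1 / sinh y - m * (cosh y / sinh y) * sinh_quot k y) has_real_derivative
     (- cosh y / (sinh y * sinh y) - m * ((sinh y * sinh y - cosh y * cosh y) / (sinh y * sinh y) * q
        + cosh y / sinh y * sinh_quot' k y))) (at y)"
    using s unfolding q_def
    by - (rule derivative_eq_intros DERIV_sinh_quot assms refl | simp add: algebra_simps)+
  moreover have "- cosh y / (sinh y * sinh y) - m * ((sinh y * sinh y - cosh y * cosh y) / (sinh y * sinh y) * q
        + cosh y / sinh y * sinh_quot' k y) = m\<^sup>2 * q - (m + 1)\<^sup>2 * sinh_quot (Suc k) y"
  proof -
    \<comment> \<open>Both \<open>e1\<close> and \<open>e2\<close> have denominator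
      \<open>(sinh y)\<^sup>2\<close>, so after \<open>cosh_sq\<close> only a polynomial identity in
      \<open>sinh y\<close>, \<open>cosh y\<close>, \<open>m\<close> and \<open>q\<close>
      remains.\<close>
    have e1: "cosh y / sinh y * sinh_quot' k y = (cosh y - m * (cosh y * cosh y) * q) / (sinh y)\<^sup>2"
      using s by (simp add: sinh_quot'_def m_def q_def divide_simps) (simp add: power2_eq_square algebra_simps)
    have e2: "(m + 1)\<^sup>2 * sinh_quot (Suc k) y = (m + 1) * (cosh y - m * q) / (sinh y)\<^sup>2"
    proof -
      have "m + 1 \<noteq> 0" by (simp add: m_def)
      then show ?thesis
        using s by (simp add: sinh_quot_Suc[OF assms] m_def[symmetric] q_def divide_simps)
           (simp add: m_def q_def power2_eq_square algebra_simps)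
    qed
    show ?thesis
      unfolding e1 e2 cosh_sq using s
      by (simp add: divide_simps) (simp add: power2_eq_square algebra_simps)
  qed
  ultimately have "((\<lambda>y. 1 / sinh y - m * (cosh y / sinh y) * sinh_quot k y) has_real_derivative
      m\<^sup>2 * q - (m + 1)\<^sup>2 * sinh_quot (Suc k) y) (at y)"
    by (rule DERIV_cong)
  moreover have "2 * real k + 2 = m + 1" by (simp add: m_def)
  ultimately show ?thesis
    unfolding sinh_quot'_def[abs_def] by (simp only: m_def q_def)
qed

lemma sinh_quot_upper:
  assumes "0 < y"
  shows "(2 * real k + 1) * sinh_quot k y \<le> y / sinh y"
  using sinh_int_upper[of y k] assms
  by (simp add: sinh_quot_def divide_simps)

lemma sinh_quot_lower:
  assumes "0 < y"
  shows "1 / cosh y \<le> (2 * real k + 1) * sinh_quot k y"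
  using sinh_int_lower[of y k] assms
  by (simp add: sinh_quot_def divide_simps algebra_simps)

section \<open>Moments on the half-line\<close>

text \<open>This nonzero limit is the source of the inhomogeneous term in the recurrence for
  \<open>moment1\<close>.\<close>

lemma at_right_sinh_quot: "(sinh_quot k \<longlongrightarrow> 1 / (2 * real k + 1)) (at_right 0)"
proof (rule tendsto_sandwich)
  have "1 / cosh y / (2 * real k + 1) \<le> sinh_quot k y" "sinh_quot k y \<le> y / sinh y / (2 * real k + 1)"
    if "0 < y" for y
    using sinh_quot_lower[OF that, of k] sinh_quot_upper[OF that, of k]
    by (subst pos_divide_le_eq pos_le_divide_eq; simp add: mult.commute)+
  then show "\<forall>\<^sub>F y in at_right 0. 1 / cosh y / (2 * real k + 1) \<le> sinh_quot k y"
      "\<forall>\<^sub>F y in at_right 0. sinh_quot k y \<le> y / sinh y / (2 * real k + 1)"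
    unfolding eventually_at_right_field by (auto intro!: exI[of _ 1])
  have "((\<lambda>y::real. 1 / cosh y) \<longlongrightarrow> 1) (at_right 0)" "((\<lambda>y::real. y / sinh y) \<longlongrightarrow> 1) (at_right 0)"
    unfolding sinh_field_def cosh_field_def by real_asymp+
  then show "((\<lambda>y. 1 / cosh y / (2 * real k + 1)) \<longlongrightarrow> 1 / (2 * real k + 1)) (at_right 0)"
      "((\<lambda>y. y / sinh y / (2 * real k + 1)) \<longlongrightarrow> 1 / (2 * real k + 1)) (at_right 0)"
    by (intro tendsto_divide tendsto_const; simp; linarith)+
qed

lemma sinh_quot_nonneg:
  assumes "0 < y" shows "0 \<le> sinh_quot k y"
  unfolding sinh_quot_def using sinh_int_nonneg[of y k] assms by simp

lemma sinh_quot_le: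
  assumes "0 < y" shows "sinh_quot k y \<le> y / sinh y"
proof -
  have "sinh_quot k y \<le> (2 * real k + 1) * sinh_quot k y"
    using sinh_quot_nonneg[OF assms, of k] by (simp add: mult_le_cancel_right1)
  then show ?thesis using sinh_quot_upper[OF assms, of k] by linarith
qed

lemma at_top_sinh_quot: "(sinh_quot k \<longlongrightarrow> 0) at_top"
proof (rule tendsto_sandwich)
  show "\<forall>\<^sub>F y in at_top. 0 \<le> sinh_quot k y"
    using eventually_gt_at_top[of 0] by eventually_elim (rule sinh_quot_nonneg)
  show "\<forall>\<^sub>F y in at_top. sinh_quot k y \<le> y / sinh y"
    using eventually_gt_at_top[of 0] by eventually_elim (rule sinh_quot_le)
  show "((\<lambda>y::real. y / sinh y) \<longlongrightarrow> 0) at_top"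
    unfolding sinh_field_def by real_asymp
qed simp

text \<open>\<open>sinh_quot' k y\<close> decreases in \<open>(2 * k + 1) * sinh_quot k y\<close>,
  so the two bounds on that product swap roles; with \<open>1 / cosh y\<close> the factor
  \<open>cosh y\<close> cancels and 0 is left. Both bounds are independent of
  \<open>k\<close>.\<close>

lemma sinh_quot'_bounds:
  assumes "0 < y"
  shows "1 / sinh y - cosh y / sinh y * (y / sinh y) \<le> sinh_quot' k y" "sinh_quot' k y \<le> 0"
proof -
  have *: "sinh_quot' k y = 1 / sinh y - cosh y / sinh y * ((2 * real k + 1) * sinh_quot k y)"
    by (simp add: sinh_quot'_def)
  have "cosh y / sinh y * ((2 * real k + 1) * sinh_quot k y) \<le> cosh y / sinh y * (y / sinh y)"
    by (rule mult_left_mono[OF sinh_quot_upper[OF assms]]) (use assms in simp)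
  then show "1 / sinh y - cosh y / sinh y * (y / sinh y) \<le> sinh_quot' k y" using * by linarith
  have "cosh y / sinh y * (1 / cosh y) \<le> cosh y / sinh y * ((2 * real k + 1) * sinh_quot k y)"
    by (rule mult_left_mono[OF sinh_quot_lower[OF assms]]) (use assms in simp)
  moreover have "cosh y / sinh y * (1 / cosh y) = 1 / sinh y" by simp
  ultimately show "sinh_quot' k y \<le> 0" using * by linarith
qed

lemma at_right_sinh_quot': "(sinh_quot' k \<longlongrightarrow> 0) (at_right 0)"
proof (rule tendsto_sandwich)
  show "\<forall>\<^sub>F y in at_right 0. 1 / sinh y - cosh y / sinh y * (y / sinh y) \<le> sinh_quot' k y"
    unfolding eventually_at_right_field using sinh_quot'_bounds(1) by (auto intro!: exI[of _ 1])
  show "\<forall>\<^sub>F y in at_right 0. sinh_quot' k y \<le> 0"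
    unfolding eventually_at_right_field using sinh_quot'_bounds(2) by (auto intro!: exI[of _ 1])
  show "((\<lambda>y::real. 1 / sinh y - cosh y / sinh y * (y / sinh y)) \<longlongrightarrow> 0) (at_right 0)"
    unfolding sinh_field_def cosh_field_def by real_asymp
qed simp

text \<open>The weight \<open>y\<close> occurs in the boundary term of the first moment; the
  unweighted limit follows on dividing by \<open>y\<close>.\<close>

lemma at_top_mult_sinh_quot': "((\<lambda>y. y * sinh_quot' k y) \<longlongrightarrow> 0) at_top"
proof (rule tendsto_sandwich)
  show "\<forall>\<^sub>F y in at_top. y * (1 / sinh y - cosh y / sinh y * (y / sinh y)) \<le> y * sinh_quot' k y"
    using eventually_gt_at_top[of 0]
    by eventually_elim (use sinh_quot'_bounds(1) in \<open>auto intro!: mult_left_mono\<close>)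
  show "\<forall>\<^sub>F y in at_top. y * sinh_quot' k y \<le> 0"
    using eventually_gt_at_top[of 0]
    by eventually_elim (use sinh_quot'_bounds(2) in \<open>auto intro!: mult_nonneg_nonpos\<close>)
  show "((\<lambda>y::real. y * (1 / sinh y - cosh y / sinh y * (y / sinh y))) \<longlongrightarrow> 0) at_top"
    unfolding sinh_field_def cosh_field_def by real_asymp
qed simp

lemma at_top_sinh_quot': "(sinh_quot' k \<longlongrightarrow> 0) at_top"
proof -
  have "((\<lambda>y. 1 / y * (y * sinh_quot' k y)) \<longlongrightarrow> 0 * 0) at_top"
    by (rule tendsto_mult[OF _ at_top_mult_sinh_quot']) real_asymp
  moreover have "\<forall>\<^sub>F y in at_top. 1 / y * (y * sinh_quot' k y) = sinh_quot' k y"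
    using eventually_gt_at_top[of 0] by eventually_elim auto
  ultimately show ?thesis by (auto elim: Lim_transform_eventually)
qed

text \<open>The endpoints enter as limits because the primitives to be used divide by
  \<open>sinh y\<close>, which vanishes at 0.\<close>

lemma FTC_greaterThan:
  fixes f F :: "real \<Rightarrow> real"
  assumes "\<And>x. 0 < x \<Longrightarrow> (F has_real_derivative f x) (at x)"
    and "\<And>x. 0 < x \<Longrightarrow> isCont f x"
    and "set_integrable lborel {0<..} f"
    and "(F \<longlongrightarrow> A) (at_right 0)" "(F \<longlongrightarrow> B) at_top"
  shows "(LBINT x:{0<..}. f x) = B - A"
proof -
  have "(LBINT x=ereal 0..\<infinity>. f x) = B - A"
    by (rule interval_integral_FTC_integrable[where F = F])
       (use assms in \<open>simp_all add: has_real_derivative_iff_has_vector_derivative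
          einterval_eq ereal_tendsto_simps\<close>)
  then show ?thesis
    by (simp add: interval_lebesgue_integral_def einterval_eq)
qed

lemma set_integrable_exp_minus_half: "set_integrable lborel {0<..} (\<lambda>y::real. exp (- y / 2))"
proof -
  have "((\<lambda>y::real. - 2 * exp (- y / 2)) \<longlongrightarrow> - 2) (at_right 0)"
       "((\<lambda>y::real. - 2 * exp (- y / 2)) \<longlongrightarrow> 0) at_top"
    by real_asymp+
  note lim = this
  have "set_integrable lborel (einterval (ereal 0) \<infinity>) (\<lambda>y::real. exp (- y / 2))"
    by (rule interval_integral_FTC_nonneg[where F = "\<lambda>y. - 2 * exp (- y / 2)" and A = "-2" and B = 0])
       (use lim in \<open>auto intro!: derivative_eq_intros simp: ereal_tendsto_simps\<close>)
  then show ?thesis by (simp add: einterval_eq)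
qed

text \<open>\<open>2 * sinh y * exp (- y / 2)\<close> equals
  \<open>exp (y / 2) - exp (- (3 * y / 2))\<close>, which is at least
  \<open>y / 2 + y\<^sup>2 / 8\<close> by Taylor. The linear term gives the constant 4, the
  quadratic one the constant 16. These are the integrable majorants for both moments.\<close>

lemma sinh_exp_bound:
  assumes "0 < (y::real)"
  shows "y / sinh y \<le> 4 * exp (- y / 2)" "y * (y / sinh y) \<le> 16 * exp (- y / 2)"
proof -
  have "exp (y / 2) - exp (- (3 * y / 2)) = 2 * sinh y * exp (- y / 2)"
    by (simp add: sinh_field_def algebra_simps mult_exp_exp)
  moreover have "1 + y / 2 + (y / 2)\<^sup>2 / 2 \<le> exp (y / 2)"
    using assms by (intro exp_lower_Taylor_quadratic) simp
  moreover have "exp (- (3 * y / 2)) \<le> 1" using assms by simp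
  moreover have "(y / 2)\<^sup>2 / 2 = y\<^sup>2 / 8" by (simp add: power2_eq_square)
  ultimately have *: "y / 2 + y\<^sup>2 / 8 \<le> 2 * sinh y * exp (- y / 2)"
    by linarith
  have s: "sinh y > 0" using assms by simp
  have "y \<le> 4 * exp (- y / 2) * sinh y"
    using * zero_le_power2[of y] by (simp only: mult_ac)
  then show "y / sinh y \<le> 4 * exp (- y / 2)"
    using s by (simp add: divide_simps)
  have "y * y \<le> 16 * exp (- y / 2) * sinh y"
    using * assms by (simp add: algebra_simps power2_eq_square)
  then show "y * (y / sinh y) \<le> 16 * exp (- y / 2)"
    using s by (simp add: divide_simps)
qed

lemma borel_measurable_sinh_cosh [measurable]:
  "(sinh :: real \<Rightarrow> real) \<in> borel_measurable borel" "(cosh :: real \<Rightarrow> real) \<in> borel_measurable borel"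
  by (auto intro!: borel_measurable_continuous_onI continuous_intros)

lemma borel_measurable_sinh_int [measurable]: "sinh_int k \<in> borel_measurable borel"
  by (intro borel_measurable_continuous_onI continuous_on_sinh_int)

lemma borel_measurable_sinh_quot [measurable]: "sinh_quot k \<in> borel_measurable borel"
  unfolding sinh_quot_def[abs_def] by measurable

lemma set_integrable_sinh_quot:
  "set_integrable lborel {0<..} (sinh_quot k)"
  "set_integrable lborel {0<..} (\<lambda>y. y * sinh_quot k y)"
proof -
  show "set_integrable lborel {0<..} (sinh_quot k)"
  proof (rule set_integrable_bound)
    show "set_integrable lborel {0<..} (\<lambda>y::real. 4 * exp (- y / 2))"
      using set_integrable_exp_minus_half by simp
    show "AE y in lborel. y \<in> {0<..} \<longrightarrow> norm (sinh_quot k y) \<le> norm (4 * exp (- y / 2))"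
      using sinh_quot_le[of _ k] sinh_exp_bound(1) sinh_quot_nonneg[of _ k]
      by (force intro!: AE_I2)
  qed (simp add: set_borel_measurable_def)
  show "set_integrable lborel {0<..} (\<lambda>y. y * sinh_quot k y)"
  proof (rule set_integrable_bound)
    show "set_integrable lborel {0<..} (\<lambda>y::real. 16 * exp (- y / 2))"
      using set_integrable_exp_minus_half by simp
    show "AE y in lborel. y \<in> {0<..} \<longrightarrow> norm (y * sinh_quot k y) \<le> norm (16 * exp (- y / 2))"
    proof (intro AE_I2 impI)
      fix y :: real assume "y \<in> {0<..}"
      then have y: "0 < y" by simp
      have "y * sinh_quot k y \<le> y * (y / sinh y)"
        using y by (intro mult_left_mono sinh_quot_le) auto
      then show "norm (y * sinh_quot k y) \<le> norm (16 * exp (- y / 2))"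
        using sinh_exp_bound(2)[OF y] sinh_quot_nonneg[OF y, of k] y by simp
    qed
  qed (simp add: set_borel_measurable_def)
qed

section \<open>Recurrences for the moments\<close>

text \<open>\<open>moment0 k\<close> is the \<open>B k\<close> of the opening text, and
  \<open>moment1 k\<close> its \<open>A k\<close>.\<close>

definition moment0 :: "nat \<Rightarrow> real" where
  "moment0 k = (LBINT y:{0<..}. sinh_quot k y)"

definition moment1 :: "nat \<Rightarrow> real" where
  "moment1 k = (LBINT y:{0<..}. y * sinh_quot k y)"

lemma isCont_sinh_quot: "0 < y \<Longrightarrow> isCont (sinh_quot k) y"
  using DERIV_sinh_quot DERIV_isCont by blast

text \<open>The integral of the second derivative of \<open>sinh_quot k\<close> is zero, since
  \<open>sinh_quot' k\<close> tends to 0 at both ends.\<close>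

lemma moment0_Suc: "(2 * real k + 2)\<^sup>2 * moment0 (Suc k) = (2 * real k + 1)\<^sup>2 * moment0 k"
proof -
  let ?f = "\<lambda>y. (2 * real k + 1)\<^sup>2 * sinh_quot k y - (2 * real k + 2)\<^sup>2 * sinh_quot (Suc k) y"
  have "(LBINT y:{0<..}. ?f y) = 0 - 0"
    by (rule FTC_greaterThan[OF DERIV_sinh_quot' _ _ at_right_sinh_quot' at_top_sinh_quot'])
       (auto intro!: continuous_intros isCont_sinh_quot set_integral_diff set_integrable_sinh_quot
          set_integrable_mult_right)
  moreover have "(LBINT y:{0<..}. ?f y) = (2 * real k + 1)\<^sup>2 * moment0 k - (2 * real k + 2)\<^sup>2 * moment0 (Suc k)"
    unfolding moment0_def by (subst set_integral_diff)
      (auto intro!: set_integrable_sinh_quot)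
  ultimately show ?thesis by simp
qed

text \<open>Integration by parts: \<open>y * sinh_quot' k y - sinh_quot k y\<close> is a primitive
  of \<open>y\<close> times the second derivative. Only its limit \<open>- 1 / (2 * k + 1)\<close>
  at 0 contributes.\<close>

lemma moment1_Suc:
  "(2 * real k + 2)\<^sup>2 * moment1 (Suc k) = (2 * real k + 1)\<^sup>2 * moment1 k - 1 / (2 * real k + 1)"
proof -
  let ?f = "\<lambda>y. (2 * real k + 1)\<^sup>2 * (y * sinh_quot k y) - (2 * real k + 2)\<^sup>2 * (y * sinh_quot (Suc k) y)"
  have "(LBINT y:{0<..}. ?f y) = (0 - 0) - (0 * 0 - 1 / (2 * real k + 1))"
  proof (rule FTC_greaterThan)
    show "((\<lambda>y. y * sinh_quot' k y - sinh_quot k y) has_real_derivative ?f y) (at y)" if "0 < y" for y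
      by (rule derivative_eq_intros DERIV_sinh_quot[OF that] DERIV_sinh_quot'[OF that] refl
            | simp add: algebra_simps)+
    show "((\<lambda>y. y * sinh_quot' k y - sinh_quot k y) \<longlongrightarrow> 0 * 0 - 1 / (2 * real k + 1)) (at_right 0)"
      by (intro tendsto_intros at_right_sinh_quot at_right_sinh_quot')
    show "((\<lambda>y. y * sinh_quot' k y - sinh_quot k y) \<longlongrightarrow> 0 - 0) at_top"
      by (intro tendsto_diff at_top_mult_sinh_quot' at_top_sinh_quot)
  qed (auto intro!: continuous_intros isCont_sinh_quot set_integral_diff set_integrable_sinh_quot
          set_integrable_mult_right)
  moreover have "(LBINT y:{0<..}. ?f y) = (2 * real k + 1)\<^sup>2 * moment1 k - (2 * real k + 2)\<^sup>2 * moment1 (Suc k)"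
    unfolding moment1_def by (subst set_integral_diff)
      (auto intro!: set_integrable_sinh_quot)
  ultimately show ?thesis by simp
qed

text \<open>Needed because \<open>J2_tilde\<close> divides by \<open>J2 0\<close>.\<close>

lemma moment0_0_pos: "0 < moment0 0"
proof -
  have "moment0 0 \<noteq> 0"
  proof
    assume "moment0 0 = 0"
    then have "AE y in lborel. indicator {0<..} y *\<^sub>R sinh_quot 0 y = 0"
      unfolding moment0_def set_lebesgue_integral_def
      by (subst (asm) integral_nonneg_eq_0_iff_AE)
         (use set_integrable_sinh_quot(1)[of 0] in \<open>auto simp: set_integrable_def indicator_def sinh_quot_nonneg\<close>)
    \<comment> \<open>On \<open>{0<..1}\<close> the integrand \<open>y / sinh y\<close> is nonzero,
      so this interval of length 1 would have to be a null set.\<close>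
    then have "AE y in lborel. y \<notin> {0<..1::real}"
      by eventually_elim (auto simp: sinh_quot_def)
    then have "{0<..1::real} \<in> null_sets lborel"
      by (subst AE_iff_null_sets) auto
    then have "emeasure lborel {0<..1::real} = 0" by (rule null_setsD1)
    then show False by simp
  qed
  moreover have "0 \<le> moment0 0"
    unfolding moment0_def set_lebesgue_integral_def
    by (rule integral_nonneg_AE) (auto simp: indicator_def sinh_quot_nonneg)
  ultimately show ?thesis by simp
qed

section \<open>Closed forms of the moments\<close>

lemma gbinomial_minus_half_Suc:
  "((- 1 / 2 :: real) gchoose Suc k) = - ((2 * real k + 1) / (2 * real k + 2)) * ((- 1 / 2) gchoose k)"
proof -
  define b where "b = ((- 1 / 2 :: real) gchoose k)"
  define c where "c = ((- 1 / 2 :: real) gchoose Suc k)"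
  have "- 1 / 2 * b = real k * b + real (Suc k) * c"
    unfolding b_def c_def by (rule gbinomial_mult_1)
  then have "c * (2 * real k + 2) = - ((2 * real k + 1) * b)" by (simp add: algebra_simps)
  then show ?thesis
    unfolding b_def[symmetric] c_def[symmetric] by (simp add: field_simps)
qed

lemma gbinomial_minus_half_nonzero: "((- 1 / 2 :: real) gchoose k) \<noteq> 0"
proof (induction k)
  case (Suc k)
  have "2 * real k + 1 \<noteq> 0" "2 * real k + 2 \<noteq> 0" by linarith+
  then show ?case using Suc unfolding gbinomial_minus_half_Suc by simp
qed simp

lemma moment0_eq: "moment0 k = moment0 0 * ((- 1 / 2) gchoose k)\<^sup>2"
proof (induction k)
  case (Suc k)
  have "moment0 (Suc k) = ((2 * real k + 1) / (2 * real k + 2))\<^sup>2 * moment0 k"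
    using moment0_Suc[of k] by (simp add: power_divide field_simps)
  then show ?case unfolding Suc gbinomial_minus_half_Suc by (simp only: power_mult_distrib power2_minus mult_ac)
qed simp

text \<open>Variation of constants: the squared binomial coefficient solves the homogeneous
  recurrence, and dividing by it makes the recurrence telescope. The cube combines the boundary term
  \<open>1 / (2 * j + 1)\<close> with the squared ratio of successive coefficients.\<close>

lemma moment1_eq:
  "moment1 k = ((- 1 / 2) gchoose k)\<^sup>2 *
    (moment1 0 - (\<Sum>j<k. 1 / (2 * real j + 1) ^ 3 * ((- 1 / 2) gchoose j) powi (- 2)))"
proof (induction k)
  case (Suc k)
  define m where "m = 2 * real k + 1"
  define b where "b = ((- 1 / 2 :: real) gchoose k)"
  define S where "S = (\<Sum>j<k. 1 / (2 * real j + 1) ^ 3 * ((- 1 / 2 :: real) gchoose j) powi (- 2))"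
  have b: "b \<noteq> 0" unfolding b_def by (rule gbinomial_minus_half_nonzero)
  have m: "m > 0" by (simp add: m_def)
  have "(m + 1)\<^sup>2 * moment1 (Suc k) = m\<^sup>2 * moment1 k - 1 / m"
    using moment1_Suc[of k] by (simp add: m_def add.assoc)
  then have "moment1 (Suc k) = (m\<^sup>2 * (b\<^sup>2 * (moment1 0 - S)) - 1 / m) / (m + 1)\<^sup>2"
    unfolding Suc b_def[symmetric] S_def[symmetric] using m by (simp add: field_simps)
  also have "\<dots> = (- (m / (m + 1)) * b)\<^sup>2 * (moment1 0 - (S + 1 / m ^ 3 * b powi (- 2)))"
  proof -
    have "b powi (- 2) = 1 / b\<^sup>2" by (simp add: power_int_def divide_inverse power_inverse)
    then show ?thesis using b m
      by (simp add: power_mult_distrib power_divide divide_simps) (simp add: algebra_simps power2_eq_square power3_eq_cube)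
  qed
  also have "- (m / (m + 1)) * b = ((- 1 / 2 :: real) gchoose Suc k)"
    unfolding gbinomial_minus_half_Suc m_def b_def by (simp only: add.assoc one_add_one)
  finally show ?case by (simp add: S_def m_def b_def)
qed simp

section \<open>Binomial transforms\<close>

text \<open>By Pascal's rule the sum for \<open>Suc n\<close> at \<open>x\<close> is the sum for
  \<open>n\<close> at \<open>x\<close> minus that at \<open>x + 1\<close>; hence the induction is
  over arbitrary \<open>x\<close>.\<close>

lemma sum_alternating_binomial_inverse:
  fixes x :: "'a::field_char_0"
  assumes "\<And>k. x + of_nat k \<noteq> 0"
  shows "(\<Sum>k\<le>n. (- 1) ^ k * of_nat (n choose k) / (x + of_nat k)) = fact n / pochhammer x (Suc n)"
  using assms
proof (induction n arbitrary: x)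
  case (Suc n)
  have x1: "(x + 1) + of_nat k \<noteq> 0" for k using Suc.prems[of "Suc k"] by (simp add: add_ac)
  let ?f = "\<lambda>n x k. (- 1) ^ k * of_nat (n choose k) / (x + of_nat k :: 'a)"
  have "(\<Sum>k\<le>Suc n. ?f (Suc n) x k) = ?f (Suc n) x 0 + (\<Sum>k\<le>n. ?f (Suc n) x (Suc k))"
    by (rule sum.atMost_Suc_shift)
  also have "(\<Sum>k\<le>n. ?f (Suc n) x (Suc k)) = (\<Sum>k\<le>n. ?f n x (Suc k)) - (\<Sum>k\<le>n. ?f n (x + 1) k)"
    unfolding sum_subtractf[symmetric]
  proof (rule sum.cong)
    fix k assume "k \<in> {..n}"
    have "x + 1 + of_nat k = x + of_nat (Suc k)" by (simp add: add_ac)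
    then show "?f (Suc n) x (Suc k) = ?f n x (Suc k) - ?f n (x + 1) k"
      by (simp only: diff_divide_distrib[symmetric]) (simp add: algebra_simps)
  qed simp
  also have "?f (Suc n) x 0 + ((\<Sum>k\<le>n. ?f n x (Suc k)) - (\<Sum>k\<le>n. ?f n (x + 1) k))
      = (\<Sum>k\<le>Suc n. ?f n x k) - (\<Sum>k\<le>n. ?f n (x + 1) k)"
    by (subst sum.atMost_Suc_shift) simp
  also have "(\<Sum>k\<le>Suc n. ?f n x k) = (\<Sum>k\<le>n. ?f n x k)" by simp
  also have "\<dots> - (\<Sum>k\<le>n. ?f n (x + 1) k)
      = fact n / pochhammer x (Suc n) - fact n / pochhammer (x + 1) (Suc n)"
    using Suc.IH[of x] Suc.IH[of "x + 1"] Suc.prems x1 by simp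
  also have "\<dots> = fact (Suc n) / pochhammer x (Suc (Suc n))"
  proof -
    have x: "x \<noteq> 0" "x + 1 + of_nat n \<noteq> 0" using Suc.prems[of 0] x1[of n] by auto
    have "pochhammer (x + 1) n \<noteq> 0"
      using x1 by (auto simp: pochhammer_eq_0_iff) (metis add.right_inverse add_uminus_conv_diff)
    then show ?thesis
      using x by (simp add: pochhammer_rec[of x] pochhammer_Suc[of "x + 1"] divide_simps)
         (simp add: algebra_simps)
  qed
  finally show ?case .
qed simp

text \<open>Trades the second-order operator in \<open>n\<close> for multiplication and a shift in
  \<open>k\<close>, which can then be moved onto the transformed sequence. At \<open>n = 0\<close>
  the truncated \<open>n - 1\<close> carries the factor 0.\<close>

lemma binomial_recurrence:
  fixes n k :: nat
  shows "4 * (real n + 1)\<^sup>2 * real (Suc n choose k) - (8 * (real n)\<^sup>2 + 8 * real n + 3) * real (n choose k)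
      + 4 * (real n)\<^sup>2 * real (n - 1 choose k)
    = (2 * real k + 1)\<^sup>2 * real (n choose k) + 4 * (real k)\<^sup>2 * (if k = 0 then 0 else real (n choose (k - 1)))"
proof (cases n)
  case 0
  then show ?thesis by (cases "k = 0 \<or> k = 1") (auto simp: binomial_eq_0)
next
  case n: (Suc m)
  show ?thesis
  proof (cases k)
    case 0
    then show ?thesis by (simp add: power2_eq_square algebra_simps)
  next
    case k: (Suc j)
    define p q b N K where "p = real (n choose k)" and "q = real (n choose j)"
      and "b = real (m choose j)" and "N = real n" and "K = real k"
    have 1: "real (Suc n choose k) = p + q"
      by (simp add: p_def q_def k)
    have 2: "real (m choose k) = p - b"
      by (simp add: p_def b_def n k)
    \<comment> \<open>Facts \<open>3\<close> and \<open>4\<close> are the two absorption identities.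
      They eliminate \<open>b\<close> and, applied twice, trade factors \<open>N + 1\<close> for
      factors \<open>K\<close>.\<close>
    have 3: "N * b = K * p"
      using Suc_times_binomial_eq[of m j] unfolding N_def K_def p_def b_def n k
      by (metis of_nat_mult mult.commute)
    have 4: "(N + 1) * q = K * (p + q)"
    proof -
      have "real (Suc n * (n choose j)) = real ((Suc n choose Suc j) * Suc j)"
        by (simp only: Suc_times_binomial_eq)
      then show ?thesis
        unfolding 1[symmetric] by (simp add: N_def K_def q_def k algebra_simps)
    qed
    have "4 * (N + 1)\<^sup>2 * (p + q) - (8 * N\<^sup>2 + 8 * N + 3) * p + 4 * N\<^sup>2 * (p - b)
       = p + 4 * (N + 1) * ((N + 1) * q) - 4 * N * (N * b)"
      by (simp add: power2_eq_square algebra_simps)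
    also have "\<dots> = p + 4 * (N + 1) * (K * (p + q)) - 4 * N * (K * p)"
      by (simp only: 3 4)
    also have "\<dots> = p + 4 * K * p + 4 * K * ((N + 1) * q)"
      by (simp add: algebra_simps)
    also have "\<dots> = (2 * K + 1)\<^sup>2 * p + 4 * K\<^sup>2 * q"
      unfolding 4 by (simp add: power2_eq_square algebra_simps)
    finally have 5: "4 * (N + 1)\<^sup>2 * (p + q) - (8 * N\<^sup>2 + 8 * N + 3) * p + 4 * N\<^sup>2 * (p - b)
       = (2 * K + 1)\<^sup>2 * p + 4 * K\<^sup>2 * q" .
    have "real (n - 1 choose k) = p - b" "(if k = 0 then 0 else real (n choose (k - 1))) = q"
      using 2 by (simp_all add: n k q_def)
    then show ?thesis using 5 unfolding 1 by (simp only: p_def N_def K_def)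
  qed
qed

definition bin_transform :: "(nat \<Rightarrow> real) \<Rightarrow> nat \<Rightarrow> real" where
  "bin_transform c n = (\<Sum>k\<le>n. (- 1) ^ k * real (n choose k) * c k)"

lemma bin_transform_extend:
  "n \<le> m \<Longrightarrow> bin_transform c n = (\<Sum>k\<le>m. (- 1) ^ k * real (n choose k) * c k)"
  unfolding bin_transform_def by (rule sum.mono_neutral_left) (auto simp: binomial_eq_0)

text \<open>Summation by parts: after \<open>binomial_recurrence\<close>, a shift of
  \<open>k\<close> moves the operator onto \<open>c\<close>. The hypothesis leaves
  \<open>2 / (2 * k + 1)\<close>, that is \<open>1 / (1 / 2 + k)\<close>, whose alternating binomial
  sum is known.\<close>

lemma bin_transform_recurrence:
  assumes c: "\<And>k. 4 * (real k + 1)\<^sup>2 * c (Suc k) = (2 * real k + 1)\<^sup>2 * c k - 2 / (2 * real k + 1)"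
  shows "4 * (real n + 1)\<^sup>2 * bin_transform c (Suc n)
      - (8 * (real n)\<^sup>2 + 8 * real n + 3) * bin_transform c n
      + 4 * (real n)\<^sup>2 * bin_transform c (n - 1) = 2 * fact n / pochhammer (3 / 2) n"
proof -
  have "4 * (real n + 1)\<^sup>2 * bin_transform c (Suc n)
      - (8 * (real n)\<^sup>2 + 8 * real n + 3) * bin_transform c n
      + 4 * (real n)\<^sup>2 * bin_transform c (n - 1)
      = (\<Sum>k\<le>Suc n. (- 1) ^ k * c k * (4 * (real n + 1)\<^sup>2 * real (Suc n choose k)
        - (8 * (real n)\<^sup>2 + 8 * real n + 3) * real (n choose k) + 4 * (real n)\<^sup>2 * real (n - 1 choose k)))"
    by (simp only: bin_transform_extend[of "Suc n" "Suc n"] bin_transform_extend[of n "Suc n"]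
        bin_transform_extend[of "n - 1" "Suc n"] sum_distrib_left sum_subtractf[symmetric] sum.distrib[symmetric])
       (rule sum.cong, auto simp: algebra_simps)
  also have "\<dots> = (\<Sum>k\<le>Suc n. (- 1) ^ k * c k * (2 * real k + 1)\<^sup>2 * real (n choose k))
      + (\<Sum>k\<le>Suc n. (- 1) ^ k * c k * 4 * (real k)\<^sup>2 * (if k = 0 then 0 else real (n choose (k - 1))))"
    unfolding binomial_recurrence sum.distrib[symmetric] by (rule sum.cong) (auto simp: algebra_simps)
  \<comment> \<open>The term \<open>k = 0\<close> vanishes, and the shift of the index flips the
    sign.\<close>
  also have "(\<Sum>k\<le>Suc n. (- 1) ^ k * c k * 4 * (real k)\<^sup>2 * (if k = 0 then 0 else real (n choose (k - 1))))
      = (\<Sum>k\<le>n. - ((- 1) ^ k * real (n choose k) * (4 * (real k + 1)\<^sup>2 * c (Suc k))))"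
    by (subst sum.atMost_Suc_shift) (auto intro!: sum.cong simp: algebra_simps)
  also have "(\<Sum>k\<le>Suc n. (- 1) ^ k * c k * (2 * real k + 1)\<^sup>2 * real (n choose k))
      = (\<Sum>k\<le>n. (- 1) ^ k * c k * (2 * real k + 1)\<^sup>2 * real (n choose k))"
    by simp
  also have "\<dots> + (\<Sum>k\<le>n. - ((- 1) ^ k * real (n choose k) * (4 * (real k + 1)\<^sup>2 * c (Suc k))))
     = (\<Sum>k\<le>n. (- 1) ^ k * real (n choose k) / (1 / 2 + real k))"
    unfolding c sum.distrib[symmetric]
    by (rule sum.cong) (auto simp: divide_simps, simp_all add: algebra_simps)
  also have "\<dots> = fact n / pochhammer (1 / 2) (Suc n)"
    by (rule sum_alternating_binomial_inverse) (simp add: add_pos_nonneg less_imp_neq)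
  also have "\<dots> = 2 * fact n / pochhammer (3 / 2) n"
    by (simp add: pochhammer_rec)
  finally show ?thesis .
qed

section \<open>Reduction of the multiple integrals\<close>

text \<open>The substitution \<open>t = y + x\<close>, \<open>v = y - x\<close> is done as two
  affine changes in one variable with Tonelli between them. The factor 2 is the Jacobian, and
  positivity of both variables becomes \<open>-y < x < y\<close>.\<close>

lemma nn_integral_quadrant:
  fixes G :: "real \<Rightarrow> real \<Rightarrow> ennreal"
  assumes [measurable]: "(\<lambda>(t, v). G t v) \<in> borel_measurable (borel \<Otimes>\<^sub>M borel)"
  shows "(\<integral>\<^sup>+t. \<integral>\<^sup>+v. indicator {0<..} t * indicator {0<..} v * G t v \<partial>lborel \<partial>lborel)
    = 2 * (\<integral>\<^sup>+y. \<integral>\<^sup>+x. indicator {0<..} y * indicator {-y<..<y} x * G (y + x) (y - x) \<partial>lborel \<partial>lborel)"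
proof -
  let ?H = "\<lambda>t v. indicator {0<..} t * indicator {0<..} v * G t v :: ennreal"
  have "(\<integral>\<^sup>+t. \<integral>\<^sup>+v. ?H t v \<partial>lborel \<partial>lborel) = (\<integral>\<^sup>+t. 2 * (\<integral>\<^sup>+y. ?H t (- t + 2 * y) \<partial>lborel) \<partial>lborel)"
  proof (intro nn_integral_cong)
    fix t :: real
    have "(\<integral>\<^sup>+v. ?H t v \<partial>lborel) = ennreal \<bar>2\<bar> * (\<integral>\<^sup>+y. ?H t (- t + 2 * y) \<partial>lborel)"
      by (rule nn_integral_real_affine) auto
    then show "(\<integral>\<^sup>+v. ?H t v \<partial>lborel) = 2 * (\<integral>\<^sup>+y. ?H t (- t + 2 * y) \<partial>lborel)" by simp
  qed
  also have "\<dots> = 2 * (\<integral>\<^sup>+t. \<integral>\<^sup>+y. ?H t (- t + 2 * y) \<partial>lborel \<partial>lborel)"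
    by (rule nn_integral_cmult) measurable
  also have "(\<integral>\<^sup>+t. \<integral>\<^sup>+y. ?H t (- t + 2 * y) \<partial>lborel \<partial>lborel) = (\<integral>\<^sup>+y. \<integral>\<^sup>+t. ?H t (- t + 2 * y) \<partial>lborel \<partial>lborel)"
    by (rule lborel_pair.Fubini') measurable
  also have "\<dots> = (\<integral>\<^sup>+y. \<integral>\<^sup>+x. ?H (y + x) (y - x) \<partial>lborel \<partial>lborel)"
  proof (rule nn_integral_cong)
    fix y :: real
    have "(\<integral>\<^sup>+t. ?H t (- t + 2 * y) \<partial>lborel) = ennreal \<bar>1\<bar> * (\<integral>\<^sup>+x. ?H (y + 1 * x) (- (y + 1 * x) + 2 * y) \<partial>lborel)"
      by (rule nn_integral_real_affine) auto
    then show "(\<integral>\<^sup>+t. ?H t (- t + 2 * y) \<partial>lborel) = (\<integral>\<^sup>+x. ?H (y + x) (y - x) \<partial>lborel)"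
      by (simp add: algebra_simps)
  qed
  also have "\<dots> = (\<integral>\<^sup>+y. \<integral>\<^sup>+x. indicator {0<..} y * indicator {-y<..<y} x * G (y + x) (y - x) \<partial>lborel \<partial>lborel)"
    by (intro nn_integral_cong) (auto simp: indicator_def)
  finally show ?thesis .
qed

text \<open>The integrand is constant on each segment \<open>s + u = v\<close>, and this contributes
  the weight \<open>v\<close>; it reduces the triple integral \<open>J3\<close> to a double
  one.\<close>

lemma nn_integral_quadrant_sum:
  fixes F :: "real \<Rightarrow> ennreal"
  assumes [measurable]: "F \<in> borel_measurable borel"
  shows "(\<integral>\<^sup>+s. \<integral>\<^sup>+u. indicator {0<..} s * indicator {0<..} u * F (s + u) \<partial>lborel \<partial>lborel)
    = (\<integral>\<^sup>+v. indicator {0<..} v * (ennreal v * F v) \<partial>lborel)"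
proof -
  have "(\<integral>\<^sup>+s. \<integral>\<^sup>+u. indicator {0<..} s * indicator {0<..} u * F (s + u) \<partial>lborel \<partial>lborel)
     = 2 * (\<integral>\<^sup>+y. \<integral>\<^sup>+x. indicator {0<..} y * indicator {-y<..<y} x * F (2 * y) \<partial>lborel \<partial>lborel)"
    by (subst nn_integral_quadrant) auto
  also have "(\<integral>\<^sup>+y. \<integral>\<^sup>+x. indicator {0<..} y * indicator {-y<..<y} x * F (2 * y) \<partial>lborel \<partial>lborel)
    = (\<integral>\<^sup>+y. indicator {0<..} (2 * y) * (ennreal (2 * y) * F (2 * y)) \<partial>lborel)"
  proof (intro nn_integral_cong)
    fix y :: real
    have "(\<integral>\<^sup>+x. indicator {0<..} y * indicator {-y<..<y} x * F (2 * y) \<partial>lborel)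
       = (\<integral>\<^sup>+x. (indicator {0<..} y * F (2 * y)) * indicator {-y<..<y} x \<partial>lborel)"
      by (simp add: mult_ac)
    also have "\<dots> = indicator {0<..} (2 * y) * (ennreal (2 * y) * F (2 * y))"
      by (subst nn_integral_cmult_indicator) (auto simp: indicator_def mult_ac)
    finally show "(\<integral>\<^sup>+x. indicator {0<..} y * indicator {-y<..<y} x * F (2 * y) \<partial>lborel) = \<dots>" .
  qed
  also have "2 * \<dots> = (\<integral>\<^sup>+v. indicator {0<..} v * (ennreal v * F v) \<partial>lborel)"
    \<comment> \<open>Rescaling \<open>v = 2 * y\<close> on the right produces the factor 2.\<close>
    by (subst (2) nn_integral_real_affine[where c = 2 and t = 0]) auto
  finally show ?thesis .
qed

section \<open>The kernel in centred coordinates\<close>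

text \<open>The integrand of both integrals: in \<open>J3\<close> the argument \<open>v\<close> is \<open>s + u\<close>.\<close>

definition kern :: "nat \<Rightarrow> real \<Rightarrow> real \<Rightarrow> real" where
  "kern n t v = exp (- (t + v) / 2) / (1 - exp (- (t + v))) *
     ((1 - exp (- 2 * t)) * (1 - exp (- 2 * v)) / (1 - exp (- (t + v)))\<^sup>2) ^ n"

lemma borel_measurable_kern [measurable (raw)]:
  assumes [measurable]: "f \<in> borel_measurable M" "g \<in> borel_measurable M"
  shows "(\<lambda>x. kern n (f x) (g x)) \<in> borel_measurable M"
  unfolding kern_def by measurable

lemma kern_nonneg: "0 < t \<Longrightarrow> 0 < v \<Longrightarrow> 0 \<le> kern n t v"
  unfolding kern_def by (intro mult_nonneg_nonneg zero_le_power divide_nonneg_nonneg) auto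

text \<open>Since the arguments add up to \<open>2 * y\<close>, the identity rests on \<open>sinh (y
  + x) * sinh (y - x) = (sinh y)\<^sup>2 - (sinh x)\<^sup>2\<close>; the proof checks it rationally
  in \<open>a = exp x\<close> and \<open>b = exp y\<close>.\<close>

lemma kern_centered:
  assumes "0 < y"
  shows "kern n (y + x) (y - x) = 1 / (2 * sinh y) * (1 - (sinh x / sinh y)\<^sup>2) ^ n"
proof -
  define a where "a = exp x"
  define b where "b = exp y"
  have pos: "a > 0" "b > 1" using assms by (auto simp: a_def b_def)
  have b2: "b\<^sup>2 > 1" "b * b > 1" using pos(2) by (simp_all add: less_1_mult)
  have e: "exp (- y) = 1 / b" "exp (- (y + x + (y - x))) = 1 / b\<^sup>2"
    "exp (- (y + x + (y - x)) / 2) = 1 / b"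
    "exp (- 2 * (y + x)) = 1 / (a\<^sup>2 * b\<^sup>2)" "exp (- 2 * (y - x)) = a\<^sup>2 / b\<^sup>2"
    by (simp_all add: a_def b_def power2_eq_square exp_minus[symmetric] exp_add[symmetric] exp_diff[symmetric]
          inverse_eq_divide[symmetric] mult_exp_exp algebra_simps del: mult_minus_left)
  have sy: "sinh y = (b\<^sup>2 - 1) / (2 * b)"
    using pos by (simp add: sinh_field_def exp_minus b_def[symmetric] field_simps power2_eq_square)
  have sx: "sinh x = (a\<^sup>2 - 1) / (2 * a)"
    using pos by (simp add: sinh_field_def exp_minus a_def[symmetric] field_simps power2_eq_square)
  have 1: "1 / b / (1 - 1 / b\<^sup>2) = 1 / (2 * sinh y)"
    unfolding sy using pos b2 by (simp add: divide_simps power2_eq_square)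
  have 2: "(1 - 1 / (a\<^sup>2 * b\<^sup>2)) * (1 - a\<^sup>2 / b\<^sup>2) / (1 - 1 / b\<^sup>2)\<^sup>2 = 1 - (sinh x / sinh y)\<^sup>2"
    unfolding sy sx using pos b2
    by (simp add: divide_simps) (simp add: algebra_simps power2_eq_square)
  show ?thesis unfolding kern_def e 1 2 ..
qed

text \<open>For \<open>y > 0\<close> this is the integral of \<open>kern n (y + x) (y - x)\<close>
  over \<open>-y < x < y\<close>, expanded binomially.\<close>

definition kern_sum :: "nat \<Rightarrow> real \<Rightarrow> real" where
  "kern_sum n y = (\<Sum>k\<le>n. (- 1) ^ k * real (n choose k) * sinh_quot k y)"

text \<open>An odd primitive in \<open>x\<close> of the binomial power in
  \<open>kern_centered\<close>.\<close>

definition kern_prim :: "nat \<Rightarrow> real \<Rightarrow> real \<Rightarrow> real" where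
  "kern_prim n y x = (\<Sum>k\<le>n. (- 1) ^ k * real (n choose k) * (sinh_int k x / sinh y ^ (2 * k)))"

lemma DERIV_kern_prim:
  "(kern_prim n y has_real_derivative (1 - (sinh x / sinh y)\<^sup>2) ^ n) (at x)"
proof -
  have "(kern_prim n y has_real_derivative
     (\<Sum>k\<le>n. (- 1) ^ k * real (n choose k) * (sinh x ^ (2 * k) / sinh y ^ (2 * k)))) (at x)"
    unfolding kern_prim_def[abs_def]
    by (intro derivative_intros DERIV_sum DERIV_cmult DERIV_cdivide DERIV_sinh_int)
  moreover have "(\<Sum>k\<le>n. (- 1) ^ k * real (n choose k) * (sinh x ^ (2 * k) / sinh y ^ (2 * k)))
     = (- (sinh x / sinh y)\<^sup>2 + 1) ^ n"
    unfolding binomial_ring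
    by (rule sum.cong) (auto simp: power_divide power_mult power_minus[of "_\<^sup>2 / _"])
  ultimately show ?thesis by simp
qed

lemma kern_prim_minus: "kern_prim n y (- x) = - kern_prim n y x"
  by (simp add: kern_prim_def sinh_int_minus sum_negf)

lemma kern_prim_at: "0 < y \<Longrightarrow> kern_prim n y y = sinh y * kern_sum n y"
  unfolding kern_prim_def kern_sum_def sinh_quot_def sum_distrib_left
  by (rule sum.cong) auto

lemma kern_base_bounds:
  assumes "0 < y" "\<bar>x\<bar> \<le> (y::real)"
  shows "0 \<le> 1 - (sinh x / sinh y)\<^sup>2" "1 - (sinh x / sinh y)\<^sup>2 \<le> 1"
proof -
  have "sinh (-y) \<le> sinh x" "sinh x \<le> sinh y"
    using assms(2) by (simp_all only: sinh_real_le_iff)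
  then have "\<bar>sinh x\<bar> \<le> sinh y" by (simp only: sinh_minus)
  moreover have "sinh y > 0" using assms by simp
  ultimately have "(sinh x)\<^sup>2 \<le> (sinh y)\<^sup>2"
    by (metis abs_ge_zero power2_abs power_mono)
  then show "0 \<le> 1 - (sinh x / sinh y)\<^sup>2"
    using \<open>sinh y > 0\<close> by (simp add: power_divide divide_simps)
qed simp

text \<open>The signs alternate, so termwise bounds fail. The mean value theorem for
  \<open>kern_prim\<close> on the interval from 0 to \<open>y\<close> gives
  \<open>y / sinh y\<close> times a power of a number between 0 and 1.\<close>

lemma kern_sum_bounds:
  assumes "0 < y"
  shows "0 \<le> kern_sum n y" "kern_sum n y \<le> y / sinh y"
proof -
  obtain z where z: "0 < z" "z < y" "kern_prim n y y - kern_prim n y 0 = (y - 0) * (1 - (sinh z / sinh y)\<^sup>2) ^ n"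
    using MVT2[OF assms DERIV_kern_prim] by blast
  have s: "sinh y > 0" using assms by simp
  have "kern_prim n y 0 = 0" by (simp add: kern_prim_def)
  then have "sinh y * kern_sum n y = y * (1 - (sinh z / sinh y)\<^sup>2) ^ n"
    using z(3) kern_prim_at[OF assms] by simp
  then have *: "kern_sum n y = y / sinh y * (1 - (sinh z / sinh y)\<^sup>2) ^ n"
    using s by (simp add: field_simps)
  have b: "0 \<le> 1 - (sinh z / sinh y)\<^sup>2" "1 - (sinh z / sinh y)\<^sup>2 \<le> 1"
    using kern_base_bounds[of y z] z by auto
  show "0 \<le> kern_sum n y" unfolding * using b(1) assms s by (intro mult_nonneg_nonneg zero_le_power) auto
  show "kern_sum n y \<le> y / sinh y" unfolding *
    using power_le_one[OF b] assms s by (intro mult_left_le) auto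
qed

lemma nn_integral_kern_base:
  assumes y: "0 < y"
  shows "(\<integral>\<^sup>+x. indicator {-y<..<y} x * ennreal ((1 - (sinh x / sinh y)\<^sup>2) ^ n) \<partial>lborel)
     = ennreal (2 * sinh y * kern_sum n y)"
proof -
  have "(\<integral>\<^sup>+x. indicator {-y<..<y} x * ennreal ((1 - (sinh x / sinh y)\<^sup>2) ^ n) \<partial>lborel)
     = (\<integral>\<^sup>+x. ennreal ((1 - (sinh x / sinh y)\<^sup>2) ^ n) * indicator {-y..y} x \<partial>lborel)"
  proof (rule nn_integral_cong_AE)
    show "AE x in lborel. indicator {-y<..<y} x * ennreal ((1 - (sinh x / sinh y)\<^sup>2) ^ n)
        = ennreal ((1 - (sinh x / sinh y)\<^sup>2) ^ n) * indicator {-y..y} x"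
      \<comment> \<open>The endpoints form a null set, so the closed interval of the fundamental
        theorem may replace the open one.\<close>
      using AE_lborel_singleton[of y] AE_lborel_singleton[of "-y"]
      by eventually_elim (auto simp: indicator_def)
  qed
  also have "\<dots> = ennreal (kern_prim n y y - kern_prim n y (- y))"
    by (rule nn_integral_FTC_Icc)
       (use y in \<open>auto intro!: DERIV_kern_prim zero_le_power kern_base_bounds\<close>)
  also have "kern_prim n y y - kern_prim n y (- y) = 2 * sinh y * kern_sum n y"
    by (simp add: kern_prim_minus kern_prim_at[OF y])
  finally show ?thesis .
qed

text \<open>The reflection \<open>x \<mapsto> - x\<close> replaces the weight \<open>y - x\<close> by its mean \<open>y\<close>.\<close>

lemma nn_integral_kern_base_weighted:
  assumes y: "0 < y"
  shows "(\<integral>\<^sup>+x. indicator {-y<..<y} x * (ennreal (y - x) * ennreal ((1 - (sinh x / sinh y)\<^sup>2) ^ n)) \<partial>lborel)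
     = ennreal (y * (2 * sinh y * kern_sum n y))" (is "?I = _")
proof -
  let ?r = "\<lambda>x. ennreal ((1 - (sinh x / sinh y)\<^sup>2) ^ n)"
  let ?J = "\<integral>\<^sup>+x. indicator {-y<..<y} x * (ennreal (y + x) * ?r x) \<partial>lborel"
  have "?I = ennreal \<bar>-1\<bar> * (\<integral>\<^sup>+x. indicator {-y<..<y} (0 + (-1) * x) * (ennreal (y - (0 + (-1) * x)) * ?r (0 + (-1) * x)) \<partial>lborel)"
    by (rule nn_integral_real_affine) auto
  also have "\<dots> = ?J"
    by (auto intro!: nn_integral_cong simp: indicator_def)
  \<comment> \<open>The weights \<open>y - x\<close> and \<open>y + x\<close> of \<open>?I\<close>
    and its reflection \<open>?J\<close> add up to the constant \<open>2 * y\<close>.\<close>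
  finally have "2 * ?I = ?I + ?J" by (simp add: mult_2)
  also have "\<dots> = (\<integral>\<^sup>+x. ennreal (2 * y) * (indicator {-y<..<y} x * ?r x) \<partial>lborel)"
  proof (subst nn_integral_add[symmetric])
    show "(\<integral>\<^sup>+x. indicator {-y<..<y} x * (ennreal (y - x) * ?r x) + indicator {-y<..<y} x * (ennreal (y + x) * ?r x) \<partial>lborel)
      = (\<integral>\<^sup>+x. ennreal (2 * y) * (indicator {-y<..<y} x * ?r x) \<partial>lborel)"
    proof (intro nn_integral_cong)
      fix x
      show "indicator {-y<..<y} x * (ennreal (y - x) * ?r x) + indicator {-y<..<y} x * (ennreal (y + x) * ?r x)
         = ennreal (2 * y) * (indicator {-y<..<y} x * ?r x)"
        by (cases "x \<in> {-y<..<y}") (auto simp: distrib_right[symmetric] ennreal_plus[symmetric] simp del: ennreal_plus)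
    qed
  qed measurable
  also have "\<dots> = ennreal (2 * y) * ennreal (2 * sinh y * kern_sum n y)"
    by (subst nn_integral_cmult) (auto simp: nn_integral_kern_base[OF y])
  also have "\<dots> = 2 * ennreal (y * (2 * sinh y * kern_sum n y))"
    using y kern_sum_bounds(1)[OF y, of n] by (simp add: ennreal_mult mult_ac)
  finally show ?thesis
    by (simp add: ennreal_mult_cancel_left)
qed

lemma set_integrable_kern_sum:
  "set_integrable lborel {0<..} (kern_sum n)" "set_integrable lborel {0<..} (\<lambda>y. y * kern_sum n y)"
  and set_integral_kern_sum:
  "(LBINT y:{0<..}. kern_sum n y) = bin_transform moment0 n"
  "(LBINT y:{0<..}. y * kern_sum n y) = bin_transform moment1 n"
proof -
  have *: "indicator {0<..} y *\<^sub>R kern_sum n y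
      = (\<Sum>k\<le>n. ((- 1) ^ k * real (n choose k)) * (indicator {0<..} y *\<^sub>R sinh_quot k y))"
    "indicator {0<..} y *\<^sub>R (y * kern_sum n y)
      = (\<Sum>k\<le>n. ((- 1) ^ k * real (n choose k)) * (indicator {0<..} y *\<^sub>R (y * sinh_quot k y)))" for y
    by (simp_all add: kern_sum_def sum_distrib_left mult_ac)
  let ?c = "\<lambda>k. (- 1) ^ k * real (n choose k)"
  have lin: "(LBINT y. (\<Sum>k\<le>n. ?c k * q k y)) = (\<Sum>k\<le>n. ?c k * (LBINT y. q k y))"
    if "\<And>k. integrable lborel (q k)" for q :: "nat \<Rightarrow> real \<Rightarrow> real"
  proof -
    have "(LBINT y. (\<Sum>k\<le>n. ?c k * q k y)) = (\<Sum>k\<le>n. LBINT y. ?c k * q k y)"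
      by (rule Bochner_Integration.integral_sum) (rule integrable_mult_right, rule that)
    then show ?thesis by simp
  qed
  show "set_integrable lborel {0<..} (kern_sum n)" "set_integrable lborel {0<..} (\<lambda>y. y * kern_sum n y)"
    unfolding set_integrable_def *
    by - (intro Bochner_Integration.integrable_sum integrable_mult_right set_integrable_sinh_quot[unfolded set_integrable_def])+
  show "(LBINT y:{0<..}. kern_sum n y) = bin_transform moment0 n"
    "(LBINT y:{0<..}. y * kern_sum n y) = bin_transform moment1 n"
    unfolding set_lebesgue_integral_def * bin_transform_def moment0_def moment1_def
    by (rule lin[where q = "\<lambda>k y. indicator {0<..} y *\<^sub>R sinh_quot k y"]
             lin[where q = "\<lambda>k y. indicator {0<..} y *\<^sub>R (y * sinh_quot k y)"],
        rule set_integrable_sinh_quot[unfolded set_integrable_def])+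
qed

lemma borel_measurable_kern_sum [measurable]: "kern_sum n \<in> borel_measurable borel"
  unfolding kern_sum_def[abs_def] by measurable

lemma nn_integral_eq_set_integral:
  fixes f :: "real \<Rightarrow> real"
  assumes "set_integrable lborel {0<..} f" "\<And>y. 0 < y \<Longrightarrow> 0 \<le> f y"
  shows "(\<integral>\<^sup>+y. indicator {0<..} y * ennreal (f y) \<partial>lborel) = ennreal (LBINT y:{0<..}. f y)"
proof -
  have "(\<integral>\<^sup>+y. indicator {0<..} y * ennreal (f y) \<partial>lborel) = (\<integral>\<^sup>+y. ennreal (indicator {0<..} y *\<^sub>R f y) \<partial>lborel)"
    by (intro nn_integral_cong) (auto simp: indicator_def)
  then show ?thesis
    unfolding set_lebesgue_integral_def using assms
    by (subst nn_integral_eq_integral[symmetric]) (auto simp: set_integrable_def indicator_def)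
qed

lemma bin_transform_moment_nonneg:
  "0 \<le> bin_transform moment0 n" "0 \<le> bin_transform moment1 n"
  unfolding set_integral_kern_sum[symmetric] set_lebesgue_integral_def
  by (auto intro!: integral_nonneg_AE simp: indicator_def kern_sum_bounds(1))

text \<open>The majorant \<open>y / sinh y\<close> of \<open>kern_sum n y\<close> is
  \<open>sinh_quot 0 y\<close>. Its independence of \<open>n\<close> later bounds the coefficients
  of the power series.\<close>

lemma bin_transform_moment_le:
  "bin_transform moment0 n \<le> moment0 0" "bin_transform moment1 n \<le> moment1 0"
proof -
  have "kern_sum n y \<le> sinh_quot 0 y" if "0 < y" for y
    using kern_sum_bounds(2)[OF that] by (simp add: sinh_quot_def)
  then show "bin_transform moment0 n \<le> moment0 0" "bin_transform moment1 n \<le> moment1 0"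
    unfolding set_integral_kern_sum[symmetric] moment0_def moment1_def
    by (auto intro!: set_integral_mono set_integrable_kern_sum set_integrable_sinh_quot
        mult_left_mono)
qed

section \<open>Evaluation of \<open>J2\<close> and \<open>J3\<close>\<close>

lemma J2_eq: "J2 n = 2 * bin_transform moment0 n"
proof -
  have "J2 n = (\<integral>p. indicator {0<..} (fst p) * indicator {0<..} (snd p) * kern n (fst p) (snd p) \<partial>(lborel \<Otimes>\<^sub>M lborel))"
    unfolding J2_def set_lebesgue_integral_def kern_def lborel_prod
    by (simp add: indicator_times case_prod_beta)
  \<comment> \<open>Nonnegativity allows the passage to extended integrals, where Tonelli and the
    substitutions apply; the final value is finite.\<close>
  also have "\<dots> = enn2real (\<integral>\<^sup>+p. ennreal (indicator {0<..} (fst p) * indicator {0<..} (snd p) * kern n (fst p) (snd p)) \<partial>(lborel \<Otimes>\<^sub>M lborel))"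
    by (rule integral_eq_nn_integral) (auto simp: indicator_def kern_nonneg)
  also have "(\<integral>\<^sup>+p. ennreal (indicator {0<..} (fst p) * indicator {0<..} (snd p) * kern n (fst p) (snd p)) \<partial>(lborel \<Otimes>\<^sub>M lborel))
    = (\<integral>\<^sup>+p. (case p of (t, v) \<Rightarrow> indicator {0<..} t * indicator {0<..} v * ennreal (kern n t v)) \<partial>(lborel \<Otimes>\<^sub>M lborel))"
    by (intro nn_integral_cong) (auto simp: indicator_def)
  also have "\<dots> = (\<integral>\<^sup>+t. \<integral>\<^sup>+v. indicator {0<..} t * indicator {0<..} v * ennreal (kern n t v) \<partial>lborel \<partial>lborel)"
    by (subst lborel.nn_integral_fst[symmetric]) auto
  also have "\<dots> = 2 * (\<integral>\<^sup>+y. \<integral>\<^sup>+x. indicator {0<..} y * indicator {-y<..<y} x * ennreal (kern n (y + x) (y - x)) \<partial>lborel \<partial>lborel)"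
    by (rule nn_integral_quadrant) measurable
  also have "(\<integral>\<^sup>+y. \<integral>\<^sup>+x. indicator {0<..} y * indicator {-y<..<y} x * ennreal (kern n (y + x) (y - x)) \<partial>lborel \<partial>lborel)
      = (\<integral>\<^sup>+y. indicator {0<..} y * ennreal (kern_sum n y) \<partial>lborel)"
  proof (rule nn_integral_cong)
    fix y :: real
    show "(\<integral>\<^sup>+x. indicator {0<..} y * indicator {-y<..<y} x * ennreal (kern n (y + x) (y - x)) \<partial>lborel)
      = indicator {0<..} y * ennreal (kern_sum n y)"
    proof (cases "0 < y")
      case True
      have s: "sinh y > 0" using True by simp
      have "(\<integral>\<^sup>+x. indicator {0<..} y * indicator {-y<..<y} x * ennreal (kern n (y + x) (y - x)) \<partial>lborel)
        = (\<integral>\<^sup>+x. ennreal (1 / (2 * sinh y)) * (indicator {-y<..<y} x * ennreal ((1 - (sinh x / sinh y)\<^sup>2) ^ n)) \<partial>lborel)"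
        unfolding kern_centered[OF True] using True s kern_base_bounds(1)[OF True]
        by (intro nn_integral_cong) (auto simp: indicator_def ennreal_mult'[symmetric])
      also have "\<dots> = ennreal (1 / (2 * sinh y)) * ennreal (2 * sinh y * kern_sum n y)"
        by (subst nn_integral_cmult) (auto simp: nn_integral_kern_base[OF True])
      also have "\<dots> = ennreal (kern_sum n y)"
        using s by (subst ennreal_mult'[symmetric]) auto
      finally show ?thesis using True by simp
    qed simp
  qed
  also have "\<dots> = ennreal (bin_transform moment0 n)"
    unfolding set_integral_kern_sum[symmetric]
    by (rule nn_integral_eq_set_integral) (auto simp: set_integrable_kern_sum kern_sum_bounds)
  finally show ?thesis using bin_transform_moment_nonneg(1)[of n] by (simp add: enn2real_mult)
qed

lemma J3_eq: "J3 n = 2 * bin_transform moment1 n"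
proof -
  let ?i = "indicator {0<..} :: real \<Rightarrow> ennreal"
  let ?M = "lborel \<Otimes>\<^sub>M (lborel \<Otimes>\<^sub>M lborel) :: (real \<times> real \<times> real) measure"
  let ?f = "\<lambda>p :: real \<times> real \<times> real. indicator {0<..} (fst p) * indicator {0<..} (fst (snd p))
    * indicator {0<..} (snd (snd p)) * kern n (fst p) (fst (snd p) + snd (snd p))"
  have "J3 n = (\<integral>p. ?f p \<partial>?M)"
    unfolding J3_def set_lebesgue_integral_def kern_def lborel_prod
    by (simp add: indicator_times case_prod_beta add.assoc mult.assoc)
  also have "\<dots> = enn2real (\<integral>\<^sup>+p. ennreal (?f p) \<partial>?M)"
    by (rule integral_eq_nn_integral) (auto simp: indicator_def kern_nonneg)
  also have "(\<integral>\<^sup>+p. ennreal (?f p) \<partial>?M)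
    = (\<integral>\<^sup>+p. (case p of (t, s, u) \<Rightarrow> ?i t * ?i s * ?i u * ennreal (kern n t (s + u))) \<partial>?M)"
    by (intro nn_integral_cong) (auto simp: indicator_def)
  also have "\<dots> = (\<integral>\<^sup>+t. \<integral>\<^sup>+q. (case q of (s, u) \<Rightarrow> ?i t * ?i s * ?i u * ennreal (kern n t (s + u))) \<partial>(lborel \<Otimes>\<^sub>M lborel) \<partial>lborel)"
    by (subst lborel_pair.P.nn_integral_fst[symmetric]) auto
  also have "\<dots> = (\<integral>\<^sup>+t. \<integral>\<^sup>+s. \<integral>\<^sup>+u. ?i t * ?i s * ?i u * ennreal (kern n t (s + u)) \<partial>lborel \<partial>lborel \<partial>lborel)"
    by (rule nn_integral_cong, subst lborel.nn_integral_fst[symmetric]) auto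
  \<comment> \<open>For fixed \<open>t\<close> the kernel depends on \<open>s + u\<close> only. The
    resulting weight \<open>v\<close> becomes \<open>y - x\<close> in centred coordinates and is
    then averaged to \<open>y\<close>.\<close>
  also have "\<dots> = (\<integral>\<^sup>+t. \<integral>\<^sup>+v. ?i t * ?i v * (ennreal v * ennreal (kern n t v)) \<partial>lborel \<partial>lborel)"
  proof (rule nn_integral_cong)
    fix t :: real
    have "(\<integral>\<^sup>+s. \<integral>\<^sup>+u. ?i t * ?i s * ?i u * ennreal (kern n t (s + u)) \<partial>lborel \<partial>lborel)
      = (\<integral>\<^sup>+s. \<integral>\<^sup>+u. ?i s * ?i u * (?i t * ennreal (kern n t (s + u))) \<partial>lborel \<partial>lborel)"
      by (simp add: mult_ac)
    also have "\<dots> = (\<integral>\<^sup>+v. ?i v * (ennreal v * (?i t * ennreal (kern n t v))) \<partial>lborel)"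
      by (rule nn_integral_quadrant_sum) measurable
    finally show "(\<integral>\<^sup>+s. \<integral>\<^sup>+u. ?i t * ?i s * ?i u * ennreal (kern n t (s + u)) \<partial>lborel \<partial>lborel)
      = (\<integral>\<^sup>+v. ?i t * ?i v * (ennreal v * ennreal (kern n t v)) \<partial>lborel)"
      by (simp add: mult_ac)
  qed
  also have "\<dots> = 2 * (\<integral>\<^sup>+y. \<integral>\<^sup>+x. ?i y * indicator {-y<..<y} x * (ennreal (y - x) * ennreal (kern n (y + x) (y - x))) \<partial>lborel \<partial>lborel)"
    by (rule nn_integral_quadrant) measurable
  also have "(\<integral>\<^sup>+y. \<integral>\<^sup>+x. ?i y * indicator {-y<..<y} x * (ennreal (y - x) * ennreal (kern n (y + x) (y - x))) \<partial>lborel \<partial>lborel)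
      = (\<integral>\<^sup>+y. ?i y * ennreal (y * kern_sum n y) \<partial>lborel)"
  proof (rule nn_integral_cong)
    fix y :: real
    show "(\<integral>\<^sup>+x. ?i y * indicator {-y<..<y} x * (ennreal (y - x) * ennreal (kern n (y + x) (y - x))) \<partial>lborel)
      = ?i y * ennreal (y * kern_sum n y)"
    proof (cases "0 < y")
      case True
      have s: "sinh y > 0" using True by simp
      have "(\<integral>\<^sup>+x. ?i y * indicator {-y<..<y} x * (ennreal (y - x) * ennreal (kern n (y + x) (y - x))) \<partial>lborel)
        = (\<integral>\<^sup>+x. ennreal (1 / (2 * sinh y)) * (indicator {-y<..<y} x * (ennreal (y - x) * ennreal ((1 - (sinh x / sinh y)\<^sup>2) ^ n))) \<partial>lborel)"
        unfolding kern_centered[OF True] using True s kern_base_bounds(1)[OF True]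
        by (intro nn_integral_cong) (auto simp: indicator_def ennreal_mult'[symmetric] mult_ac)
      also have "\<dots> = ennreal (1 / (2 * sinh y)) * ennreal (y * (2 * sinh y * kern_sum n y))"
        by (subst nn_integral_cmult) (auto simp: nn_integral_kern_base_weighted[OF True])
      also have "\<dots> = ennreal (y * kern_sum n y)"
        using s by (subst ennreal_mult'[symmetric]) auto
      finally show ?thesis using True by simp
    qed simp
  qed
  also have "\<dots> = ennreal (bin_transform moment1 n)"
    unfolding set_integral_kern_sum[symmetric]
    by (rule nn_integral_eq_set_integral) (auto simp: set_integrable_kern_sum kern_sum_bounds)
  finally show ?thesis using bin_transform_moment_nonneg(2)[of n] by (simp add: enn2real_mult)
qed

section \<open>Closed form, recurrence and bound for \<open>J3_tilde\<close>\<close>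

text \<open>In \<open>J2_tilde\<close> the factor \<open>moment0 0\<close> cancels, leaving the
  transform of the squared binomial coefficients. As \<open>J3 0 = 2 * moment1 0\<close>, the
  correction in \<open>J3_tilde\<close> removes the homogeneous part of
  \<open>moment1\<close>.\<close>

lemma J3_tilde_eq_bin_transform:
  "J3_tilde n = bin_transform (\<lambda>k. 2 * (moment1 k - moment1 0 * ((- 1 / 2) gchoose k)\<^sup>2)) n"
proof -
  have "bin_transform moment0 n = moment0 0 * bin_transform (\<lambda>k. ((- 1 / 2) gchoose k)\<^sup>2) n"
    unfolding bin_transform_def sum_distrib_left
    by (rule sum.cong, simp, subst moment0_eq) (simp add: mult_ac)
  moreover have "bin_transform c 0 = c 0" for c by (simp add: bin_transform_def)
  ultimately have "J2_tilde n = bin_transform (\<lambda>k. ((- 1 / 2) gchoose k)\<^sup>2) n"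
    using moment0_0_pos by (simp add: J2_tilde_def J2_eq)
  then show ?thesis
    unfolding J3_tilde_def J3_eq
    by (simp add: bin_transform_def sum_distrib_left sum_subtractf algebra_simps)
qed

lemma J3_tilde_eq: "J3_tilde n = - 2 * w3_bracket n"
  unfolding J3_tilde_eq_bin_transform bin_transform_def w3_bracket_def atMost_atLeast0
  by (subst sum_distrib_left, rule sum.cong, simp, subst moment1_eq) (simp add: algebra_simps)

lemma J3_tilde_recurrence:
  "4 * (real n + 1)\<^sup>2 * J3_tilde (Suc n) - (8 * (real n)\<^sup>2 + 8 * real n + 3) * J3_tilde n
      + 4 * (real n)\<^sup>2 * J3_tilde (n - 1) = 2 * fact n / pochhammer (3 / 2) n"
  unfolding J3_tilde_eq_bin_transform
proof (rule bin_transform_recurrence)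
  fix k
  \<comment> \<open>The squared binomial coefficient solves the homogeneous recurrence, so
    subtracting a multiple of it keeps the inhomogeneity of \<open>moment1_Suc\<close>, here
    doubled.\<close>
  have "(2 * real k + 2) * ((- 1 / 2) gchoose Suc k) = - (2 * real k + 1) * ((- 1 / 2 :: real) gchoose k)"
    unfolding gbinomial_minus_half_Suc by (simp add: add_nonneg_eq_0_iff divide_simps) (simp add: algebra_simps)
  then have "((2 * real k + 2) * ((- 1 / 2) gchoose Suc k))\<^sup>2 = ((2 * real k + 1) * ((- 1 / 2 :: real) gchoose k))\<^sup>2"
    by (metis mult_minus_left power2_minus)
  then have "4 * (real k + 1)\<^sup>2 * ((- 1 / 2) gchoose Suc k)\<^sup>2 = (2 * real k + 1)\<^sup>2 * ((- 1 / 2 :: real) gchoose k)\<^sup>2"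
    by (simp add: power2_eq_square algebra_simps)
  moreover have "X * (2 * (A - M * G)) = 2 * (X * A) - 2 * M * (X * G)" for X A M G :: real
    by (simp add: algebra_simps)
  moreover have "4 * (real k + 1)\<^sup>2 * moment1 (Suc k) = (2 * real k + 1)\<^sup>2 * moment1 k - 1 / (2 * real k + 1)"
    using moment1_Suc[of k] by (simp add: power2_eq_square algebra_simps)
  ultimately show "4 * (real k + 1)\<^sup>2 * (2 * (moment1 (Suc k) - moment1 0 * ((- 1 / 2) gchoose Suc k)\<^sup>2))
     = (2 * real k + 1)\<^sup>2 * (2 * (moment1 k - moment1 0 * ((- 1 / 2) gchoose k)\<^sup>2)) - 2 / (2 * real k + 1)"
    by (simp only: right_diff_distrib)
qed

lemma J3_tilde_0 [simp]: "J3_tilde 0 = 0"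
  by (simp add: J3_tilde_eq w3_bracket_def)

text \<open>Both \<open>J3 n\<close> and \<open>J3 0 * J2_tilde n\<close> lie between 0 and
  \<open>2 * moment1 0\<close>.\<close>

lemma J3_tilde_bounded: "\<bar>J3_tilde n\<bar> \<le> 2 * moment1 0"
proof -
  have 0: "bin_transform c 0 = c 0" for c by (simp add: bin_transform_def)
  have "0 \<le> J2_tilde n" "J2_tilde n \<le> 1"
    using bin_transform_moment_nonneg(1)[of n] bin_transform_moment_le(1)[of n] moment0_0_pos
    by (simp_all add: J2_tilde_def J2_eq 0)
  moreover have "0 \<le> moment1 0" using bin_transform_moment_nonneg(2)[of 0] by (simp add: 0)
  ultimately have "0 \<le> 2 * moment1 0 * J2_tilde n" "2 * moment1 0 * J2_tilde n \<le> 2 * moment1 0"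
    by (auto intro: mult_left_le)
  then show ?thesis
    using bin_transform_moment_nonneg(2)[of n] bin_transform_moment_le(2)[of n]
    unfolding J3_tilde_def J3_eq 0 by linarith
qed

section \<open>The Heun equation\<close>

lemma fps_conv_radius_ge_1_of_bounded:
  fixes F :: "complex fps"
  assumes "\<And>n. norm (fps_nth F n) \<le> C"
  shows "1 \<le> fps_conv_radius F"
  unfolding fps_conv_radius_def
proof (rule conv_radius_geI_ex')
  fix r :: real assume r: "0 < r" "ereal r < 1"
  show "summable (\<lambda>n. fps_nth F n * of_real r ^ n)"
  proof (rule summable_comparison_test)
    show "\<exists>N. \<forall>n\<ge>N. norm (fps_nth F n * of_real r ^ n) \<le> C * r ^ n"
      using assms r by (auto simp: norm_mult norm_power intro!: mult_right_mono)
    show "summable (\<lambda>n. C * r ^ n)"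
      using r by (intro summable_mult summable_geometric) (auto simp: one_ereal_def)
  qed
qed

lemma eval_fps_unit_disc:
  fixes F :: "complex fps"
  assumes "1 \<le> fps_conv_radius F"
  shows "eval_fps F has_fps_expansion F" "eval_fps F holomorphic_on ball 0 1"
proof -
  show "eval_fps F has_fps_expansion F"
    using less_le_trans[OF _ assms, of 0] by (intro eval_fps_has_fps_expansion) simp
  have "ball (0::complex) 1 \<subseteq> eball 0 (fps_conv_radius F)"
    using assms by (intro ball_eball_mono) (simp add: one_ereal_def)
  then show "eval_fps F holomorphic_on ball 0 1" by (rule holomorphic_on_eval_fps)
qed

definition heun_fps :: "complex fps \<Rightarrow> complex fps" where
  "heun_fps W = fps_X * (1 - fps_X)\<^sup>2 * fps_deriv (fps_deriv W)
     + (1 - 3 * fps_X) * (1 - fps_X) * fps_deriv W + (fps_X - fps_const (3 / 4)) * W"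

lemma heun_fps_nth:
  "fps_nth (heun_fps W) n = (of_nat n + 1)\<^sup>2 * fps_nth W (Suc n) - (2 * (of_nat n)\<^sup>2 + 2 * of_nat n + 3 / 4) * fps_nth W n
     + (of_nat n)\<^sup>2 * fps_nth W (n - 1)"
proof -
  let ?W' = "fps_deriv W" and ?W'' = "fps_deriv (fps_deriv W)"
  \<comment> \<open>Horner form in \<open>fps_X\<close>: each factor shifts the index once, so the
    cases 0, 1 and at least 2 settle all coefficients.\<close>
  have *: "heun_fps W = ?W' - fps_const (3 / 4) * W
      + fps_X * ((?W'' - 4 * ?W' + W) + fps_X * ((3 * ?W' - 2 * ?W'') + fps_X * ?W''))"
    unfolding heun_fps_def by (simp add: algebra_simps power2_eq_square)
  consider "n = 0" | "n = 1" | m where "n = Suc (Suc m)"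
    by (metis One_nat_def not0_implies_Suc)
  then show ?thesis
    unfolding * by cases (simp_all, simp_all add: algebra_simps power2_eq_square)
qed

lemma has_fps_expansion_heun_op:
  assumes "w has_fps_expansion W"
  shows "heun_op w has_fps_expansion heun_fps W"
  unfolding heun_op_def[abs_def] heun_fps_def
  by (intro fps_expansion_intros assms)

lemma hyp2F1_nth:
  "fps_nth (fps_hypergeo [1, 1] [3 / 2] 1) n = complex_of_real (fact n / pochhammer (3 / 2) n)"
  by (simp add: pochhammer_of_real[symmetric] pochhammer_fact[symmetric])

text \<open>The formal equation is the recurrence of \<open>J3_tilde\<close> divided by 4. Its
  leading factor \<open>(n + 1)\<^sup>2\<close> never vanishes, so the zeroth coefficient determines
  the series; this serves both existence and uniqueness.\<close>

lemma heun_fps_J3_tilde: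
  assumes "fps_nth W 0 = 0"
  shows "heun_fps W = fps_const (1 / 2) * fps_hypergeo [1, 1] [3 / 2] 1 \<longleftrightarrow>
    W = Abs_fps (\<lambda>n. complex_of_real (J3_tilde n))"
proof -
  have rec: "(of_nat n + 1)\<^sup>2 * complex_of_real (J3_tilde (Suc n))
     - (2 * (of_nat n)\<^sup>2 + 2 * of_nat n + 3 / 4) * complex_of_real (J3_tilde n)
     + (of_nat n)\<^sup>2 * complex_of_real (J3_tilde (n - 1))
     = 1 / 2 * complex_of_real (fact n / pochhammer (3 / 2) n)" for n
  proof -
    have "(real n + 1)\<^sup>2 * J3_tilde (Suc n) - (2 * (real n)\<^sup>2 + 2 * real n + 3 / 4) * J3_tilde n
     + (real n)\<^sup>2 * J3_tilde (n - 1) = 1 / 2 * (fact n / pochhammer (3 / 2) n)"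
    proof -
      have "(8 * (real n)\<^sup>2 + 8 * real n + 3) * J3_tilde n = 4 * ((2 * (real n)\<^sup>2 + 2 * real n + 3 / 4) * J3_tilde n)"
        by (simp add: algebra_simps)
      moreover have "2 * fact n / pochhammer (3 / 2 :: real) n = 2 * (fact n / pochhammer (3 / 2) n)" by simp
      ultimately show ?thesis using J3_tilde_recurrence[of n] unfolding mult.assoc by linarith
    qed
    from this[THEN arg_cong[where f = complex_of_real]] show ?thesis by simp
  qed
  show ?thesis
  proof
    assume "heun_fps W = fps_const (1 / 2) * fps_hypergeo [1, 1] [3 / 2] 1"
    then have W: "(of_nat n + 1)\<^sup>2 * fps_nth W (Suc n) - (2 * (of_nat n)\<^sup>2 + 2 * of_nat n + 3 / 4) * fps_nth W n
     + (of_nat n)\<^sup>2 * fps_nth W (n - 1) = 1 / 2 * complex_of_real (fact n / pochhammer (3 / 2) n)" for n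
      unfolding heun_fps_nth[symmetric] hyp2F1_nth[symmetric] by (simp only: fps_mult_left_const_nth)
    have "fps_nth W n = complex_of_real (J3_tilde n)" for n
    proof (induction n rule: less_induct)
      case (less n)
      show ?case
      proof (cases n)
        case 0
        then show ?thesis by (simp add: assms)
      next
        case (Suc m)
        have "fps_nth W m = complex_of_real (J3_tilde m)" "fps_nth W (m - 1) = complex_of_real (J3_tilde (m - 1))"
          using less[of m] less[of "m - 1"] Suc by simp_all
        then have "(of_nat m + 1)\<^sup>2 * fps_nth W (Suc m) = (of_nat m + 1)\<^sup>2 * complex_of_real (J3_tilde (Suc m))"
          using trans[OF W[of m] rec[of m, symmetric]] by simp
        moreover have "(of_nat m + 1 :: complex) \<noteq> 0" by (metis of_nat_Suc add.commute of_nat_eq_0_iff nat.distinct(1))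
        ultimately show ?thesis using Suc by simp
      qed
    qed
    then show "W = Abs_fps (\<lambda>n. complex_of_real (J3_tilde n))" by (simp add: fps_eq_iff)
  next
    assume "W = Abs_fps (\<lambda>n. complex_of_real (J3_tilde n))"
    then show "heun_fps W = fps_const (1 / 2) * fps_hypergeo [1, 1] [3 / 2] 1"
      unfolding fps_eq_iff heun_fps_nth fps_mult_left_const_nth hyp2F1_nth by (simp only: fps_nth_Abs_fps rec simp_thms)
  qed
qed

lemma hyp2F1_expansion:
  "hyp2F1 1 1 (3 / 2) has_fps_expansion fps_hypergeo [1, 1] [3 / 2] 1"
  "hyp2F1 1 1 (3 / 2) holomorphic_on ball 0 1"
proof -
  \<comment> \<open>Factor by factor, \<open>1 + i\<close> is at most \<open>3 / 2 + i\<close>; so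
    the coefficients are at most 1.\<close>
  have le: "fact n \<le> pochhammer (3 / 2 :: real) n" for n
    unfolding pochhammer_fact pochhammer_prod by (rule prod_mono) auto
  have "1 \<le> fps_conv_radius (fps_hypergeo [1, 1] [3 / 2] 1 :: complex fps)"
  proof (rule fps_conv_radius_ge_1_of_bounded)
    fix n
    have "0 \<le> fact n / pochhammer (3 / 2 :: real) n" "fact n / pochhammer (3 / 2 :: real) n \<le> 1"
      using le[of n] less_le_trans[OF fact_gt_zero le[of n]] by simp_all
    then show "norm (fps_nth (fps_hypergeo [1, 1] [3 / 2] 1) n :: complex) \<le> 1"
      unfolding hyp2F1_nth norm_of_real by simp
  qed
  moreover have "hyp2F1 1 1 (3 / 2) = eval_fps (fps_hypergeo [1, 1] [3 / 2] 1)"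
    by (simp add: fun_eq_iff hyp2F1_def)
  ultimately show "hyp2F1 1 1 (3 / 2) has_fps_expansion fps_hypergeo [1, 1] [3 / 2] 1"
    "hyp2F1 1 1 (3 / 2) holomorphic_on ball 0 1"
    using eval_fps_unit_disc by simp_all
qed

lemma w3_tilde_expansion:
  "1 \<le> fps_conv_radius (Abs_fps (\<lambda>n. complex_of_real (J3_tilde n)))"
  "w3_tilde has_fps_expansion Abs_fps (\<lambda>n. complex_of_real (J3_tilde n))"
  "w3_tilde holomorphic_on ball 0 1"
proof -
  show *: "1 \<le> fps_conv_radius (Abs_fps (\<lambda>n. complex_of_real (J3_tilde n)))"
    by (rule fps_conv_radius_ge_1_of_bounded[where C = "2 * moment1 0"])
       (simp add: J3_tilde_bounded)
  have "w3_tilde = eval_fps (Abs_fps (\<lambda>n. complex_of_real (J3_tilde n)))"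
    by (simp add: fun_eq_iff w3_tilde_def eval_fps_def)
  then show "w3_tilde has_fps_expansion Abs_fps (\<lambda>n. complex_of_real (J3_tilde n))"
    "w3_tilde holomorphic_on ball 0 1"
    using eval_fps_unit_disc[OF *] by simp_all
qed

text \<open>The difference of the two sides is holomorphic on the unit disc with zero power series
  at 0, hence vanishes there.\<close>

lemma heun_solution_w3_tilde: "heun_solution_on_disc 1 w3_tilde"
proof -
  let ?D = "\<lambda>z. heun_op w3_tilde z - 1 / 2 * hyp2F1 1 1 (3 / 2) z"
  let ?F = "Abs_fps (\<lambda>n. complex_of_real (J3_tilde n))"
  have "?D has_fps_expansion heun_fps ?F - fps_const (1 / 2) * fps_hypergeo [1, 1] [3 / 2] 1"
    by (intro fps_expansion_intros has_fps_expansion_heun_op w3_tilde_expansion hyp2F1_expansion)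
  moreover have "heun_fps ?F = fps_const (1 / 2) * fps_hypergeo [1, 1] [3 / 2] 1"
    by (subst heun_fps_J3_tilde) simp_all
  ultimately have "?D has_fps_expansion 0" by simp
  moreover have "?D holomorphic_on ball 0 1"
    unfolding heun_op_def by (intro holomorphic_intros w3_tilde_expansion hyp2F1_expansion open_ball)
  ultimately have "?D z = 0" if "norm z < 1" for z
    using has_fps_expansion_imp_eval_fps_eq[of ?D 0 z 1] that by simp
  then show ?thesis
    using w3_tilde_expansion(3) by (auto simp: heun_solution_on_disc_def)
qed

text \<open>The Taylor series of \<open>w\<close> satisfies the formal equation, so its coefficients
  are forced; holomorphy carries the equality to the whole disc.\<close>

lemma heun_solution_unique:
  assumes "heun_solution_on_disc r w" "w 0 = 0" "z \<in> ball 0 r"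
  shows "w z = w3_tilde z"
proof -
  have r: "0 < r" "r \<le> 1" and hol: "w holomorphic_on ball 0 r"
    and ode: "\<And>z. z \<in> ball 0 r \<Longrightarrow> heun_op w z = 1 / 2 * hyp2F1 1 1 (3 / 2) z"
    using assms(1) by (auto simp: heun_solution_on_disc_def)
  define W where "W = fps_expansion w 0"
  have W: "w has_fps_expansion W"
    unfolding W_def by (rule has_fps_expansion_fps_expansion[OF open_ball _ hol]) (use r in simp)
  have "(\<lambda>z. 1 / 2 * hyp2F1 1 1 (3 / 2) z) has_fps_expansion fps_const (1 / 2) * fps_hypergeo [1, 1] [3 / 2] 1"
    by (intro fps_expansion_intros hyp2F1_expansion)
  moreover have "eventually (\<lambda>z. heun_op w z = 1 / 2 * hyp2F1 1 1 (3 / 2) z) (nhds 0)"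
    using eventually_nhds_in_open[of "ball 0 r" 0] r ode by (auto elim!: eventually_mono)
  \<comment> \<open>An expansion depends only on values near 0, where the differential equation
    holds.\<close>
  ultimately have "heun_op w has_fps_expansion fps_const (1 / 2) * fps_hypergeo [1, 1] [3 / 2] 1"
    unfolding has_fps_expansion_def
    by (elim conjE, intro conjI) (assumption, erule (1) eventually_elim2, simp only:)
  then have "heun_fps W = fps_const (1 / 2) * fps_hypergeo [1, 1] [3 / 2] 1"
    using has_fps_expansion_heun_op[OF W] fps_expansion_unique_complex by blast
  moreover have "fps_nth W 0 = 0" using fps_nth_fps_expansion[OF W, of 0] assms(2) by simp
  ultimately have "w has_fps_expansion Abs_fps (\<lambda>n. complex_of_real (J3_tilde n))"
    using W heun_fps_J3_tilde by auto
  then have "eval_fps (Abs_fps (\<lambda>n. complex_of_real (J3_tilde n))) z = w z"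
    by (rule has_fps_expansion_imp_eval_fps_eq[OF _ _ hol]) (use assms(3) in simp)
  then show ?thesis by (simp add: w3_tilde_def eval_fps_def)
qed

theorem theorem4p3:
  shows "(heun_solution_on_disc 1 w3_tilde \<and> w3_tilde 0 = 0) \<and>
    (\<forall>r w. heun_solution_on_disc r w \<and> w 0 = 0 \<longrightarrow> (\<forall>z\<in>ball 0 r. w z = w3_tilde z)) \<and>
    (\<forall>z. norm z < 1 \<longrightarrow>
       summable (\<lambda>n. complex_of_real (w3_bracket n) * z ^ n) \<and>
       w3_tilde z = - 2 * (\<Sum>n. complex_of_real (w3_bracket n) * z ^ n)) \<and>
    (\<forall>n. J3_tilde n = - 2 * w3_bracket n)"
proof (intro conjI allI impI ballI heun_solution_w3_tilde J3_tilde_eq)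
  show "w3_tilde 0 = 0" by (simp add: w3_tilde_def powser_zero)
  show "w z = w3_tilde z" if "heun_solution_on_disc r w \<and> w 0 = 0" "z \<in> ball 0 r" for r w z
    using that heun_solution_unique by blast
  fix z :: complex assume z: "norm z < 1"
  \<comment> \<open>Reading the bracket series as \<open>- 1 / 2\<close> times that of
    \<open>J3_tilde\<close> transfers convergence on the unit disc.\<close>
  have bracket: "complex_of_real (w3_bracket n) * z ^ n = (- 1 / 2) * (complex_of_real (J3_tilde n) * z ^ n)" for n
    by (simp add: J3_tilde_eq)
  have "ereal (norm z) < fps_conv_radius (Abs_fps (\<lambda>n. complex_of_real (J3_tilde n)))"
    using z by (intro less_le_trans[OF _ w3_tilde_expansion(1)]) (simp add: one_ereal_def)
  then have sm: "summable (\<lambda>n. complex_of_real (J3_tilde n) * z ^ n)"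
    using summable_fps[of z "Abs_fps (\<lambda>n. complex_of_real (J3_tilde n))"] by simp
  then show "summable (\<lambda>n. complex_of_real (w3_bracket n) * z ^ n)"
    unfolding bracket by (rule summable_mult)
  show "w3_tilde z = - 2 * (\<Sum>n. complex_of_real (w3_bracket n) * z ^ n)"
    unfolding bracket suminf_mult[OF sm] by (simp add: w3_tilde_def)
qed

end
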